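(* Let $\Lambda:=\{3^k-3^l: k,l\in\mathbb{N}_0,\ 0\le l<k\}$. There exists an absolute constant $C_0>0$ such that $$\Bigg(\sum_{(m,n)\in\Lambda\times\Lambda}|\widehat f(m,n)|^2\Bigg)^{1/2}\le C_0\,\|f\|_{L\log L(\mathbb{T}^2)}\quad\text{for all } f\in H^1(\mathbb{T}^2).$$
   Context: $\mathbb{N}_0$ denotes the non-negative integers, and $\mathbb{T}=\mathbb{R}/(2\pi\mathbb{Z})$. The two-torus $\mathbb{T}^2$ carries its normalised Haar measure (total mass $1$), and $\widehat f(m,n)=\int_{\mathbb{T}^2}f(x,y)e^{-i(mx+ny)}$ with respect to this measure. The Hardy space is $H^1(\mathbb{T}^2)=\{f\in L^1(\mathbb{T}^2):\mathrm{supp}(\widehat f)\subseteq\mathbb{N}_0^2\}$. For measurable $f$ on $\mathbb{T}^2$, the non-increasing rearrangement is $f^{\ast}(t):=\inf\{\lambda>0:|\{|f|>\lambda\}|\le t\}$ for $t\ge0$, where $|\cdot|$ is the measure on $\mathbb{T}^2$, and $$\|f\|_{L\log L(\mathbb{T}^2)}:=\int_0^\infty(1+|\log t|)\,f^{\ast}(t)\,dt .$$ The inequality is trivially true when its right-hand side is infinite. *)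

theory Defs
  imports "HOL-Probability.Probability"
begin

text \<open>
  The circle \<open>\<real> / 2\<pi>\<int>\<close> is represented by its fundamental domain \<open>[0, 2\<pi>)\<close>. The measure on the
  two-torus is completed, so that measurability means Lebesgue measurability.
\<close>

definition circle_measure :: "real measure" where
  "circle_measure = scale_measure (ennreal (1 / (2 * pi))) (restrict_space lborel {0..<2 * pi})"

definition torus2 :: "(real \<times> real) measure" where
  "torus2 = completion (circle_measure \<Otimes>\<^sub>M circle_measure)"

lemma space_circle_measure: "space circle_measure = {0..<2 * pi}"
  by (simp add: circle_measure_def space_scale_measure space_restrict_space)

lemma prob_space_circle_measure: "prob_space circle_measure"
proof
  have "emeasure circle_measure (space circle_measure) = ennreal (1 / (2 * pi)) * ennreal (2 * pi)"
    by (simp add: circle_measure_def space_scale_measure space_restrict_space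
        emeasure_restrict_space)
  also have "\<dots> = ennreal (1 / (2 * pi) * (2 * pi))"
    by (rule ennreal_mult[symmetric]) auto
  finally show "emeasure circle_measure (space circle_measure) = 1"
    by simp
qed

lemma prob_space_torus2: "prob_space torus2"
proof -
  interpret C: prob_space circle_measure
    by (rule prob_space_circle_measure)
  interpret P: pair_prob_space circle_measure circle_measure ..
  show ?thesis
    unfolding torus2_def by (rule P.prob_space_completion)
qed

lemma space_torus2: "space torus2 = {0..<2 * pi} \<times> {0..<2 * pi}"
  by (simp add: torus2_def space_pair_measure space_circle_measure)

definition fourier_coeff :: "(real \<times> real \<Rightarrow> complex) \<Rightarrow> int \<Rightarrow> int \<Rightarrow> complex" where
  "fourier_coeff f m n =
     (LINT (x, y)|torus2. f (x, y) * exp (- \<i> * complex_of_real (of_int m * x + of_int n * y)))"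

definition hardy_H1 :: "(real \<times> real \<Rightarrow> complex) set" where
  "hardy_H1 =
     {f. integrable torus2 f \<and> {(m, n). fourier_coeff f m n \<noteq> 0} \<subseteq> {0..} \<times> {0..}}"

text \<open>The infimum is taken in \<open>[0, \<infinity>]\<close>, so it is \<open>\<infinity>\<close> when no \<open>s\<close> qualifies.\<close>

definition rearrangement :: "(real \<times> real \<Rightarrow> complex) \<Rightarrow> real \<Rightarrow> ennreal" where
  "rearrangement f t =
     (INF s\<in>{s::real. s > 0 \<and> emeasure torus2 {z \<in> space torus2. norm (f z) > s} \<le> ennreal t}.
        ennreal s)"

definition LlogL_norm :: "(real \<times> real \<Rightarrow> complex) \<Rightarrow> ennreal" where
  "LlogL_norm f = (\<integral>\<^sup>+t\<in>{0..}. (ennreal (1 + \<bar>ln t\<bar>) * rearrangement f t) \<partial>lborel)"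

definition ennreal_sqrt :: "ennreal \<Rightarrow> ennreal" where
  "ennreal_sqrt x = (if x = \<infinity> then \<infinity> else ennreal (sqrt (enn2real x)))"

definition Lambda :: "int set" where
  "Lambda = {3 ^ k - 3 ^ l | k l :: nat. l < k}"

end

(*
  On the circle, write a Hardy polynomial with values in a Hilbert space as p(u + i x), where
  z = exp(u + i x), and put J(u) = avg_x Phi(|p(u + i x)|) with Phi(s) ~ s sqrt(log s).  Then J is convex
  and increasing, and the Laplacian of Phi(|p|) shows J'' >= avg |p'|^2 / w for a weight w ~ |p| / sqrt(log |p|).
  A point u in (-2 * 3^-k, -3^-k) sees the frequencies 3^k - 3^l (l < k), and pairing p' with the matching
  trigonometric polynomial g costs avg w |g|^2.  The sum g is lacunary up to a unimodular factor, so |g|^2 is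
  exponentially integrable (Riesz products), and w log w <= Phi(|p|) / 2 makes this cost O(J(0)) by Young's
  inequality.  Summing over k, where sum_k 9^-k J''(u_k) <= J(0) by convexity, the square function of the
  coefficients on Lambda is at most C avg Phi(|p|).

  Applying this in x for fixed y, and then in y to the vector of coefficients, bounds the coefficients on
  Lambda x Lambda by avg (1 + |f|) log(e + |f|), because Phi(C Phi(s)) = O((1 + s) log(e + s)) and Jensen's
  inequality applies.  Fejer means reduce a general f to polynomials, again by Jensen, and homogeneity
  replaces the last average by the norm.
*)
theory Submission
  imports Defs
begin

section \<open>Averages over the circle and Riesz products\<close>

text \<open>The exponent 1/2 of the logarithm is forced from both sides. For Phi(s) ~ s (log s)^a
  the Laplacian of Phi(|p|) is about |p'|^2 (log |p|)^a / |p|, so w ~ |p| / (log |p|)^a and w log w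
  ~ |p| (log |p|)^(1 - a), which Phi dominates only if a >= 1/2. Two applications, one per variable,
  produce (log s)^(2 a), and L log L has room only for a <= 1/2. The obstacle is that Lambda is not
  lacunary: the frequencies of a block crowd towards 3^k, and the translation that makes the block
  lacunary depends on k. Hence each block is treated at its own radius, with u of order -3^-k, where
  its monomials still have size of order one while the derivative amplifies them by about 3^k.
  Hilbert space values let the second application handle all coefficients in the first variable at
  once. The squared norm q = |p|^2, shifted to 1 + q, serves as variable because it stays smooth
  where p vanishes.\<close>

definition circ_avg :: "(real \<Rightarrow> 'a::real_normed_vector) \<Rightarrow> 'a" where
  "circ_avg h = integral {0..2 * pi} h /\<^sub>R (2 * pi)"

lemma integrable_on_period:
  fixes h :: "real \<Rightarrow> 'a::banach"
  assumes "continuous_on UNIV h"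
  shows "h integrable_on {0..2 * pi}"
  by (rule integrable_continuous_interval) (rule continuous_on_subset[OF assms], simp)

lemma circ_avg_const [simp]: "circ_avg (\<lambda>x. c) = (c :: 'a::euclidean_space)"
  by (simp add: circ_avg_def)

lemma circ_avg_add:
  fixes g h :: "real \<Rightarrow> 'a::banach"
  assumes "continuous_on UNIV g" "continuous_on UNIV h"
  shows "circ_avg (\<lambda>x. g x + h x) = circ_avg g + circ_avg h"
  unfolding circ_avg_def
  by (simp add: integral_add integrable_on_period assms scaleR_add_right)

lemma circ_avg_sum:
  fixes h :: "'b \<Rightarrow> real \<Rightarrow> 'a::banach"
  assumes "finite S" "\<And>s. s \<in> S \<Longrightarrow> continuous_on UNIV (h s)"
  shows "circ_avg (\<lambda>x. \<Sum>s\<in>S. h s x) = (\<Sum>s\<in>S. circ_avg (h s))"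
  unfolding circ_avg_def
  by (simp add: integral_sum integrable_on_period assms scaleR_sum_right)

lemma circ_avg_mult_left:
  fixes h :: "real \<Rightarrow> 'a::{real_normed_field,euclidean_space}"
  shows "circ_avg (\<lambda>x. c * h x) = c * circ_avg h"
  unfolding circ_avg_def by simp

lemma circ_avg_mono:
  fixes g h :: "real \<Rightarrow> real"
  assumes "continuous_on UNIV g" "continuous_on UNIV h" "\<And>x. g x \<le> h x"
  shows "circ_avg g \<le> circ_avg h"
  unfolding circ_avg_def
  by (simp add: divide_right_mono integral_le integrable_on_period assms)

lemma circ_avg_Re:
  assumes "continuous_on UNIV h"
  shows "circ_avg (\<lambda>x. Re (h x)) = Re (circ_avg h)"
  unfolding circ_avg_def using integral_linear[OF integrable_on_period[OF assms] bounded_linear_Re]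
  by (simp add: o_def)

lemma circ_avg_of_real:
  fixes h :: "real \<Rightarrow> real"
  assumes "continuous_on UNIV h"
  shows "circ_avg (\<lambda>x. complex_of_real (h x)) = of_real (circ_avg h)"
  unfolding circ_avg_def
  using integral_linear[OF integrable_on_period[OF assms] bounded_linear_of_real[where 'a=complex]]
  by (simp add: o_def scaleR_conv_of_real)

lemma circ_avg_cis: "circ_avg (\<lambda>x. cis (of_int m * x)) = (if m = 0 then 1 else 0)"
proof (cases "m = 0")
  case True
  then show ?thesis by simp
next
  case False
  define F where "F = (\<lambda>z. exp (\<i> * of_int m * z) / (\<i> * of_int m))"
  have "((\<lambda>x. F (of_real x)) has_vector_derivative cis (of_int m * x)) (at x within {0..2 * pi})" for x
    by (rule has_vector_derivative_real_field)
       (auto simp: F_def cis_conv_exp False mult.assoc intro!: derivative_eq_intros)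
  then have "((\<lambda>x. cis (of_int m * x)) has_integral (F (of_real (2 * pi)) - F (of_real 0))) {0..2 * pi}"
    by (intro fundamental_theorem_of_calculus) auto
  moreover have "exp (\<i> * of_int m * of_real (2 * pi)) = (1::complex)"
    by (rule exp_eq_1[THEN iffD2]) (auto intro!: exI[of _ m])
  then have "F (of_real (2 * pi)) = F (of_real 0)"
    unfolding F_def by simp
  ultimately show ?thesis
    using False by (simp add: circ_avg_def integral_unique)
qed

lemma continuous_on_cis [continuous_intros]:
  "continuous_on S f \<Longrightarrow> continuous_on S (\<lambda>x. cis (f x))"
  unfolding cis_conv_exp by (intro continuous_intros)

text \<open>A cosine is half the sum of two exponentials, so the new factor acts on Fourier
  coefficients by shifts of plus and minus \<open>3 ^ k\<close>. This recursion drives the next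
  lemmas on Riesz products.\<close>

lemma circ_avg_riesz_product_Suc:
  fixes R :: "real \<Rightarrow> real"
  assumes R: "continuous_on UNIV R"
  shows "circ_avg (\<lambda>x. complex_of_real (R x * (a + b * cos (3 ^ k * x + t))) * cis (of_int m * x))
   = of_real a * circ_avg (\<lambda>x. of_real (R x) * cis (of_int m * x))
     + of_real (b / 2) * cis t * circ_avg (\<lambda>x. of_real (R x) * cis (of_int (m + 3 ^ k) * x))
     + of_real (b / 2) * cis (- t) * circ_avg (\<lambda>x. of_real (R x) * cis (of_int (m - 3 ^ k) * x))"
proof -
  have *: "complex_of_real (r * (a + b * cos (3 ^ k * x + t))) * cis (of_int m * x)
   = of_real a * (of_real r * cis (of_int m * x))
     + of_real (b / 2) * cis t * (of_real r * cis (of_int (m + 3 ^ k) * x))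
     + of_real (b / 2) * cis (- t) * (of_real r * cis (of_int (m - 3 ^ k) * x))" for r x
  proof -
    have "complex_of_real (cos y) = (cis y + cis (- y)) / 2" for y
      by (simp add: complex_eq_iff)
    moreover have "cis (of_int (m + 3 ^ k) * x) * cis t = cis (of_int m * x) * cis (3 ^ k * x + t)"
      "cis (of_int (m - 3 ^ k) * x) * cis (- t) = cis (of_int m * x) * cis (- (3 ^ k * x + t))"
      by (simp_all add: cis_mult algebra_simps)
    ultimately show ?thesis
      by (simp add: algebra_simps add_divide_distrib)
  qed
  have c: "continuous_on UNIV (\<lambda>x. c * (complex_of_real (R x) * cis (of_int n * x)))" for n c
    using R by (intro continuous_intros)
  have d: "continuous_on UNIV (\<lambda>x. c * (complex_of_real (R x) * cis (of_int n * x)) + c' * (complex_of_real (R x) * cis (of_int n' * x)))"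
    for n c n' c'
    using R by (intro continuous_intros)
  show ?thesis
    unfolding * circ_avg_add[OF d c] circ_avg_add[OF c c] circ_avg_mult_left ..
qed

lemma continuous_on_riesz_product:
  fixes a b t :: "nat \<Rightarrow> real"
  shows "continuous_on UNIV (\<lambda>x. \<Prod>l<k. a l + b l * cos (3 ^ l * x + t l))"
  by (intro continuous_intros)

text \<open>The first \<open>k\<close> factors only produce frequencies of modulus at most 1 + 3 +
  ... + 3^(k-1) = (3^k - 1)/2. In the induction, 2|m| >= 3^(k+1) keeps \<open>m\<close> and both of
  its shifts at distance at least 3^k / 2 from 0.\<close>

lemma riesz_product_orthogonal:
  fixes a b t :: "nat \<Rightarrow> real"
  assumes "3 ^ k \<le> 2 * \<bar>m\<bar>"
  shows "circ_avg (\<lambda>x. complex_of_real (\<Prod>l<k. a l + b l * cos (3 ^ l * x + t l)) * cis (of_int m * x)) = 0"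
  using assms
proof (induction k arbitrary: m)
  case 0
  then have "m \<noteq> 0" by auto
  then show ?case by (simp add: circ_avg_cis)
next
  case (Suc k)
  have "3 * 3 ^ k \<le> 2 * \<bar>m\<bar>" "(0::int) < 3 ^ k"
    using Suc.prems by auto
  then have "3 ^ k \<le> 2 * \<bar>m\<bar>" "3 ^ k \<le> 2 * \<bar>m + 3 ^ k\<bar>" "3 ^ k \<le> 2 * \<bar>m - 3 ^ k\<bar>"
    unfolding abs_le_iff by (auto simp: abs_if split: if_splits)
  then show ?case
    unfolding prod.lessThan_Suc circ_avg_riesz_product_Suc[OF continuous_on_riesz_product]
    by (simp only: Suc.IH) simp
qed

text \<open>The frequencies plus and minus \<open>3 ^ k\<close> are missing from the first
  \<open>k\<close> factors, so the new cosine adds nothing to the mean: lacunary cosines behave here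
  like independent centred variables.\<close>

lemma riesz_product_mean:
  fixes a b t :: "nat \<Rightarrow> real"
  shows "circ_avg (\<lambda>x. \<Prod>l<k. a l + b l * cos (3 ^ l * x + t l)) = (\<Prod>l<k. a l)"
proof (induction k)
  case 0
  then show ?case by simp
next
  case (Suc k)
  let ?R = "\<lambda>k x. \<Prod>l<k. a l + b l * cos (3 ^ l * x + t l)"
  have to_real: "circ_avg (\<lambda>x. complex_of_real (?R k x) * cis (of_int 0 * x)) = of_real (circ_avg (?R k))" for k
    using circ_avg_of_real[OF continuous_on_riesz_product[where k=k and a=a and b=b and t=t]] by simp
  have "circ_avg (\<lambda>x. complex_of_real (?R k x) * cis (of_int (0 + 3 ^ k) * x)) = 0"
       "circ_avg (\<lambda>x. complex_of_real (?R k x) * cis (of_int (0 - 3 ^ k) * x)) = 0"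
    by (rule riesz_product_orthogonal; simp)+
  then have "complex_of_real (circ_avg (?R (Suc k))) = of_real (a k * circ_avg (?R k))"
    unfolding to_real[symmetric] of_real_mult
    unfolding prod.lessThan_Suc circ_avg_riesz_product_Suc[OF continuous_on_riesz_product]
    by (simp only:) simp
  then have "circ_avg (?R (Suc k)) = a k * circ_avg (?R k)"
    using of_real_eq_iff[where 'a=complex] by blast
  then show ?case
    using Suc.IH by simp
qed

section \<open>Exponential integrability of lacunary cosine sums\<close>

lemma cosh_le_exp_square: "cosh (a::real) \<le> exp (a\<^sup>2 / 2)"
proof -
  have *: "cosh a \<le> exp (a\<^sup>2 / 2)" if "a > 0" for a :: real
  proof -
    \<comment> \<open>The auxiliary inequality of Hoeffding's lemma for a fair coin with values 0
      and 2a; its left-hand side is ln (cosh a).\<close>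
    have "- (2 * a) * (1/2) + ln (1 + (1/2) * (exp (2 * a) - 1)) \<le> (2 * a)\<^sup>2 / 8"
      using Hoeffdings_lemma_aux[of "2 * a" "1/2"] that by simp
    then have "ln (1 + (1/2) * (exp (2 * a) - 1)) \<le> a + a\<^sup>2 / 2"
      by (simp add: power2_eq_square)
    moreover have "1 + (1/2) * (exp (2 * a) - 1) = exp a * cosh a"
      by (simp add: cosh_field_def field_simps flip: exp_add)
    ultimately have "ln (exp a * cosh a) \<le> a + a\<^sup>2 / 2"
      by (simp only:)
    then have "exp (ln (exp a * cosh a)) \<le> exp (a + a\<^sup>2 / 2)"
      by (simp only: exp_le_cancel_iff)
    then have "exp a * cosh a \<le> exp (a + a\<^sup>2 / 2)"
      by (subst (asm) exp_ln) auto
    then show ?thesis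
      by (simp add: exp_add)
  qed
  show ?thesis
    using *[of "\<bar>a\<bar>"] by (cases "a = 0") auto
qed

text \<open>The graph of exp lies below its chord between \<open>- a\<close> and \<open>a\<close>.
  The bound is affine in \<open>u\<close>, so for cosines \<open>u\<close> the product of such
  bounds is a Riesz product.\<close>

lemma exp_le_cosh_sinh:
  assumes "\<bar>u\<bar> \<le> (1::real)"
  shows "exp (a * u) \<le> cosh a + sinh a * u"
proof -
  have "convex_on UNIV (exp :: real \<Rightarrow> real)"
    using convex_on_exp[of 1] by simp
  from convex_onD[OF this, of "(1 - u) / 2" a "- a"] assms
  have "exp ((1 + u) / 2 * a + (1 - u) / 2 * (- a)) \<le> (1 + u) / 2 * exp a + (1 - u) / 2 * exp (- a)"
    by (simp add: abs_le_iff field_simps)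
  then show ?thesis
    by (simp add: cosh_field_def sinh_field_def field_simps)
qed

text \<open>The chord bound leads to a Riesz product whose mean is the product of the
  \<open>cosh (r l)\<close>, which is the exponential moment of a sum of independent signs.\<close>

lemma lacunary_exp_avg:
  fixes r t :: "nat \<Rightarrow> real"
  shows "circ_avg (\<lambda>x. exp (\<Sum>l<k. r l * cos (3 ^ l * x + t l))) \<le> exp ((\<Sum>l<k. (r l)\<^sup>2) / 2)"
proof -
  have "circ_avg (\<lambda>x. exp (\<Sum>l<k. r l * cos (3 ^ l * x + t l)))
      \<le> circ_avg (\<lambda>x. \<Prod>l<k. cosh (r l) + sinh (r l) * cos (3 ^ l * x + t l))"
  proof (rule circ_avg_mono)
    show "exp (\<Sum>l<k. r l * cos (3 ^ l * x + t l)) \<le> (\<Prod>l<k. cosh (r l) + sinh (r l) * cos (3 ^ l * x + t l))" for x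
      unfolding exp_sum[OF finite_lessThan]
      by (intro prod_mono conjI exp_le_cosh_sinh) auto
  qed (intro continuous_intros)+
  also have "\<dots> \<le> (\<Prod>l<k. exp ((r l)\<^sup>2 / 2))"
    unfolding riesz_product_mean by (intro prod_mono) (auto simp: cosh_le_exp_square)
  also have "\<dots> = exp ((\<Sum>l<k. (r l)\<^sup>2) / 2)"
    by (simp add: exp_sum sum_divide_distrib)
  finally show ?thesis .
qed

lemma sum_exp_minus_half_le: "(\<Sum>j\<le>n. exp (- (real j)\<^sup>2 / 2)) \<le> 3"
proof -
  have e: "exp (- 1 / 2 :: real) \<le> 2 / 3"
  proof -
    have "3 / 2 \<le> exp (1 / 2 :: real)"
      using exp_ge_add_one_self[of "1/2"] by simp
    then have "inverse (exp (1 / 2 :: real)) \<le> inverse (3 / 2)"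
      by (intro le_imp_inverse_le) auto
    then show ?thesis
      by (simp add: exp_minus)
  qed
  have "(\<Sum>j\<le>n. exp (- (real j)\<^sup>2 / 2)) \<le> (\<Sum>j\<le>n. (2 / 3) ^ j)"
  proof (rule sum_mono)
    fix j
    have "real j \<le> (real j)\<^sup>2"
      by (cases j) (auto simp: power2_eq_square)
    then have "exp (- (real j)\<^sup>2 / 2) \<le> exp (real j * (- 1 / 2))"
      by simp
    also have "\<dots> = exp (- 1 / 2) ^ j"
      by (rule exp_of_nat_mult)
    also have "\<dots> \<le> (2 / 3) ^ j"
      by (intro power_mono e) auto
    finally show "exp (- (real j)\<^sup>2 / 2) \<le> (2 / 3) ^ j" .
  qed
  also have "\<dots> \<le> 3"
    using sum_gp0[of "2 / 3 :: real" n] by simp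
  finally show ?thesis .
qed

text \<open>The dominating term is the one where \<open>j\<close> is the integer nearest to \<open>\<bar>u\<bar> / 2\<close>.\<close>

lemma exp_square_le_sum:
  assumes "\<bar>u\<bar> \<le> real k"
  shows "exp (u\<^sup>2 / 4) \<le> 2 * (\<Sum>j\<le>k. (exp (real j * u) + exp (- (real j * u))) * exp (- (real j)\<^sup>2))"
proof -
  define j where "j = nat \<lfloor>\<bar>u\<bar> / 2 + 1 / 2\<rfloor>"
  have j: "\<bar>real j - \<bar>u\<bar> / 2\<bar> \<le> 1 / 2"
    unfolding j_def by linarith
  have "j \<le> k"
  proof (cases "k = 0")
    case False
    with assms j have "real j < real k + 1/2 \<or> real j \<le> real k" by linarith
    then show ?thesis by linarith
  qed (use assms in \<open>auto simp: j_def\<close>)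
  have "(real j - \<bar>u\<bar> / 2)\<^sup>2 \<le> (1 / 2)\<^sup>2"
    using j by (intro power2_le_iff_abs_le[THEN iffD2]) auto
  then have "u\<^sup>2 / 4 \<le> 1 / 4 + (real j * \<bar>u\<bar> - (real j)\<^sup>2)"
    by (simp add: power2_diff field_simps)
  then have "exp (u\<^sup>2 / 4) \<le> exp (1 / 4) * (exp (real j * \<bar>u\<bar>) * exp (- (real j)\<^sup>2))"
    by (simp flip: exp_add)
  also have "\<dots> \<le> 2 * ((exp (real j * u) + exp (- (real j * u))) * exp (- (real j)\<^sup>2))"
  proof (intro mult_mono)
    have "exp (1 / 4) \<le> (1 + 1/4 + (1/4)\<^sup>2 :: real)"
      by (rule exp_bound) auto
    then show "exp (1 / 4) \<le> (2::real)" by (simp add: power2_eq_square)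
    show "exp (real j * \<bar>u\<bar>) \<le> exp (real j * u) + exp (- (real j * u))"
      by (cases "u \<ge> 0") (auto simp: abs_if)
  qed auto
  also have "\<dots> \<le> 2 * (\<Sum>j\<le>k. (exp (real j * u) + exp (- (real j * u))) * exp (- (real j)\<^sup>2))"
    using \<open>j \<le> k\<close>
    by (intro mult_left_mono member_le_sum[where f="\<lambda>j. (exp (real j * u) + exp (- (real j * u))) * exp (- (real j)\<^sup>2)"]) auto
  finally show ?thesis .
qed

text \<open>Gaussian linearisation with integer parameters: exp (u^2/4) is dominated by exponentials
  of \<open>j u\<close> and \<open>- j u\<close> with weights exp (-j^2). Their means grow at most
  like exp (j^2/2), so the sum converges and 12 does not depend on \<open>k\<close>.\<close>

lemma lacunary_exp_square_avg:
  fixes r t :: "nat \<Rightarrow> real"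
  assumes "(\<Sum>l<k. (r l)\<^sup>2) \<le> 1"
  shows "circ_avg (\<lambda>x. exp ((\<Sum>l<k. r l * cos (3 ^ l * x + t l))\<^sup>2 / 4)) \<le> 12"
proof -
  define u where "u = (\<lambda>x. \<Sum>l<k. r l * cos (3 ^ l * x + t l))"
  have u [continuous_intros]: "continuous_on UNIV u"
    unfolding u_def by (intro continuous_intros)
  \<comment> \<open>A crude bound, which lets the finitely many \<open>j\<close> up to
    \<open>k\<close> suffice in \<open>exp_square_le_sum\<close>.\<close>
  have u_le: "\<bar>u x\<bar> \<le> real k" for x
  proof -
    have "\<bar>r l\<bar> \<le> 1" if "l < k" for l
    proof -
      have "(r l)\<^sup>2 \<le> (\<Sum>l<k. (r l)\<^sup>2)"
        using that by (intro member_le_sum) auto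
      with assms show ?thesis using abs_square_le_1[of "r l"] by linarith
    qed
    then have "\<bar>r l * cos (3 ^ l * x + t l)\<bar> \<le> 1" if "l < k" for l
      using mult_mono[of "\<bar>r l\<bar>" 1 "\<bar>cos (3 ^ l * x + t l)\<bar>" 1] that by (simp add: abs_mult)
    then have "(\<Sum>l<k. \<bar>r l * cos (3 ^ l * x + t l)\<bar>) \<le> (\<Sum>l<k. 1)"
      by (intro sum_mono) auto
    then show ?thesis
      unfolding u_def by (intro order_trans[OF sum_abs]) simp
  qed
  have lin: "circ_avg (\<lambda>x. exp (c * u x)) \<le> exp (c\<^sup>2 / 2)" for c
  proof -
    have "circ_avg (\<lambda>x. exp (c * u x)) \<le> exp ((\<Sum>l<k. (c * r l)\<^sup>2) / 2)"
      using lacunary_exp_avg[where k=k and r="\<lambda>l. c * r l" and t=t]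
      by (simp add: u_def sum_distrib_left mult.assoc)
    also have "\<dots> \<le> exp (c\<^sup>2 / 2)"
      using assms mult_left_mono[OF assms, of "c\<^sup>2"]
      by (simp add: power_mult_distrib sum_distrib_left)
    finally show ?thesis .
  qed
  have "circ_avg (\<lambda>x. exp ((u x)\<^sup>2 / 4))
      \<le> circ_avg (\<lambda>x. \<Sum>j\<le>k. (2 * exp (- (real j)\<^sup>2)) * (exp (real j * u x) + exp (- (real j) * u x)))"
  proof (rule circ_avg_mono)
    show "exp ((u x)\<^sup>2 / 4) \<le> (\<Sum>j\<le>k. (2 * exp (- (real j)\<^sup>2)) * (exp (real j * u x) + exp (- (real j) * u x)))" for x
      using exp_square_le_sum[OF u_le[of x]] by (simp add: sum_distrib_left mult_ac)
  qed (intro continuous_intros; simp)+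
  also have "\<dots> = (\<Sum>j\<le>k. (2 * exp (- (real j)\<^sup>2)) * (circ_avg (\<lambda>x. exp (real j * u x)) + circ_avg (\<lambda>x. exp (- (real j) * u x))))"
    by (subst circ_avg_sum, simp, intro continuous_intros, subst circ_avg_mult_left, subst circ_avg_add)
       (intro continuous_intros refl)+
  also have "\<dots> \<le> (\<Sum>j\<le>k. (2 * exp (- (real j)\<^sup>2)) * (exp ((real j)\<^sup>2 / 2) + exp ((real j)\<^sup>2 / 2)))"
    using lin[of "real _"] lin[of "- real _"]
    by (intro sum_mono mult_left_mono add_mono) auto
  also have "\<dots> = 4 * (\<Sum>j\<le>k. exp (- (real j)\<^sup>2 / 2))"
    by (simp add: sum_distrib_left flip: exp_add)
  also have "\<dots> \<le> 12"
    using sum_exp_minus_half_le[of k] by simp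
  finally show ?thesis
    unfolding u_def .
qed

section \<open>A one-variable estimate for Hilbert space valued polynomials\<close>

text \<open>In terms of \<open>q = s\<^sup>2\<close>, \<open>phi q\<close> is a smooth version of \<open>s (log s)\<^sup>1\<^sup>/\<^sup>2\<close>. Its derivatives are \<open>phi1\<close>
  and \<open>phi2\<close>, and \<open>wt\<close> is the reciprocal of the resulting lower bound \<open>4 (phi1 q + q phi2 q)\<close> for the
  Laplacian of \<open>phi (norm p\<^sup>2)\<close> relative to \<open>(norm p')\<^sup>2\<close>.\<close>

definition phi :: "real \<Rightarrow> real" where
  "phi q = sqrt ((1 + q) * (1 + ln (1 + q)))"

definition wt :: "real \<Rightarrow> real" where
  "wt q = sqrt ((1 + q) / (1 + ln (1 + q)))"

definition phi1 :: "real \<Rightarrow> real" where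
  "phi1 q = (2 + ln (1 + q)) / (2 * phi q)"

definition phi2 :: "real \<Rightarrow> real" where
  "phi2 q = - (1 + (1 + ln (1 + q))\<^sup>2) / (4 * (phi q) ^ 3)"

lemma phi_ge_1: "0 \<le> q \<Longrightarrow> 1 \<le> phi q"
  using mult_mono[of 1 "1 + q" 1 "1 + ln (1 + q)"] by (simp add: phi_def)

lemma phi_mono: "0 \<le> q \<Longrightarrow> q \<le> q' \<Longrightarrow> phi q \<le> phi q'"
  unfolding phi_def by (intro real_sqrt_le_mono mult_mono) auto

lemma wt_pos: "0 \<le> q \<Longrightarrow> 0 < wt q"
  by (simp add: wt_def add_pos_nonneg)

lemma wt_times_log: "0 \<le> q \<Longrightarrow> wt q * (1 + ln (1 + q)) = phi q"
proof -
  assume "0 \<le> q"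
  then have L: "0 < 1 + ln (1 + q)" by (simp add: add_pos_nonneg)
  then have "wt q * (1 + ln (1 + q)) = wt q * (sqrt (1 + ln (1 + q)) * sqrt (1 + ln (1 + q)))"
    by simp
  also have "\<dots> = phi q"
    unfolding wt_def phi_def real_sqrt_mult real_sqrt_divide using L by (simp del: real_sqrt_mult_self)
  finally show ?thesis .
qed

text \<open>\<open>wt q\<close> is \<open>phi q\<close> divided by the logarithm
  \<open>1 + ln (1 + q)\<close>, while \<open>ln (wt q)\<close> is at most half of that logarithm,
  since dropping the double logarithm only increases it. This becomes the entropy bound
  \<open>J u / 2\<close> in \<open>block_bound\<close>.\<close>

lemma wt_ln_wt_le: 
  assumes "0 \<le> q" shows "wt q * ln (wt q) \<le> phi q / 2"
proof -
  have L: "0 < 1 + ln (1 + q)" "0 \<le> ln (1 + ln (1 + q))" "0 \<le> ln (1 + q)"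
    using assms by (simp_all add: add_pos_nonneg)
  have "ln (wt q) = (ln (1 + q) - ln (1 + ln (1 + q))) / 2"
  proof -
    have "1 + ln (1 + q) \<noteq> 0" "1 + q \<noteq> 0"
      using L assms by linarith+
    then show ?thesis
      using L(1) assms by (simp add: wt_def ln_sqrt ln_div)
  qed
  also have "\<dots> \<le> (1 + ln (1 + q)) / 2"
  proof -
    have "x - y \<le> 1 + x" if "0 \<le> y" for x y :: real using that by linarith
    from this[OF L(2)] show ?thesis by (rule divide_right_mono) simp
  qed
  finally have "ln (wt q) \<le> (1 + ln (1 + q)) / 2" .
  then have "wt q * ln (wt q) \<le> wt q * ((1 + ln (1 + q)) / 2)"
    using wt_pos[OF assms] by (intro mult_left_mono) auto
  then show ?thesis
    using wt_times_log[OF assms] by simp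
qed

lemma phi_has_derivative:
  assumes "0 \<le> q"
  shows "(phi has_real_derivative phi1 q) (at q)"
proof -
  have L: "0 < 1 + ln (1 + q)"
    using assms by (simp add: add_pos_nonneg)
  have "((\<lambda>q. sqrt ((1 + q) * (1 + ln (1 + q)))) has_real_derivative
     ((1 + ln (1 + q)) + (1 + q) * (1 / (1 + q))) * (inverse (sqrt ((1 + q) * (1 + ln (1 + q)))) / 2)) (at q)"
    using assms L by (auto intro!: derivative_eq_intros simp: mult_less_0_iff)
  moreover have "((1 + ln (1 + q)) + (1 + q) * (1 / (1 + q))) * (inverse (sqrt ((1 + q) * (1 + ln (1 + q)))) / 2) = phi1 q"
    using assms by (simp add: phi1_def phi_def field_simps)
  ultimately show ?thesis
    unfolding phi_def[abs_def] by simp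
qed

lemma phi_square: "0 \<le> q \<Longrightarrow> (phi q)\<^sup>2 = (1 + q) * (1 + ln (1 + q))"
  by (simp add: phi_def)

lemma phi1_has_derivative:
  assumes "0 \<le> q"
  shows "(phi1 has_real_derivative phi2 q) (at q)"
proof -
  have p: "0 < phi q" using phi_ge_1[OF assms] by simp
  let ?L = "1 + ln (1 + q)"
  have "((\<lambda>q. (2 + ln (1 + q)) / (2 * phi q)) has_real_derivative
     (1 / (1 + q) * (2 * phi q) - (2 + ln (1 + q)) * (2 * phi1 q)) / ((2 * phi q) * (2 * phi q))) (at q)"
    using assms p by (auto intro!: derivative_eq_intros phi_has_derivative)
  moreover have "(1 / (1 + q) * (2 * phi q) - (2 + ln (1 + q)) * (2 * phi1 q)) / ((2 * phi q) * (2 * phi q))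
    = (2 * (phi q)\<^sup>2 / (1 + q) - (2 + ln (1 + q))\<^sup>2) / (4 * (phi q) ^ 3)"
  proof -
    have "(1 / (1 + q) * (2 * phi q) - (2 + ln (1 + q)) * (2 * phi1 q)) * phi q
        = 2 * (phi q)\<^sup>2 / (1 + q) - (2 + ln (1 + q))\<^sup>2"
    proof -
      have "(1 / t * (2 * f) - M * (2 * (M / (2 * f)))) * f = 2 * f\<^sup>2 / t - M\<^sup>2"
        if "0 < f" for t f M :: real
        using that by (simp add: left_diff_distrib power2_eq_square)
      from this[OF p] show ?thesis unfolding phi1_def by blast
    qed
    then show ?thesis
      using p mult_divide_mult_cancel_right[of "phi q" "1 / (1 + q) * (2 * phi q) - (2 + ln (1 + q)) * (2 * phi1 q)" "(2 * phi q) * (2 * phi q)"]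
      by (simp add: power3_eq_cube mult.assoc)
  qed
  moreover have "2 * (phi q)\<^sup>2 / (1 + q) - (2 + ln (1 + q))\<^sup>2 = - (1 + ?L\<^sup>2)"
  proof -
    have "(phi q)\<^sup>2 / (1 + q) = ?L"
      using assms by (simp add: phi_square)
    then have "2 * (phi q)\<^sup>2 / (1 + q) = 2 * ?L"
      by (simp only: times_divide_eq_right[symmetric])
    then show ?thesis
      by (simp only:) (simp add: power2_eq_square algebra_simps)
  qed
  ultimately show ?thesis
    unfolding phi1_def[abs_def] phi2_def by simp
qed

text \<open>Concavity of \<open>phi\<close>: with this sign the Cauchy-Schwarz upper bound on the
  gradient of q gives a lower bound of the Laplacian in \<open>J2_ge\<close>.\<close>

lemma phi2_nonpos: "0 \<le> q \<Longrightarrow> phi2 q \<le> 0"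
  unfolding phi2_def minus_divide_left[symmetric] neg_le_0_iff_le
  using phi_ge_1[of q] by (intro divide_nonneg_nonneg add_nonneg_nonneg) auto

text \<open>With L = 1 + ln (1 + q), the quantity 4 (phi1 + (1 + q) phi2) equals (L^2 + 2 L - 1) /
  (L phi), and L >= 1 leaves at least L / phi = 1 / wt. Passing from 1 + q to q drops a nonpositive
  term.\<close>

lemma phi1_phi2_ge:
  assumes "0 \<le> q"
  shows "1 / wt q \<le> 4 * (phi1 q + q * phi2 q)"
proof -
  define L where "L = 1 + ln (1 + q)"
  have L: "1 \<le> L" using assms by (simp add: L_def)
  have p: "0 < phi q" using phi_ge_1[OF assms] by simp
  have "1 / wt q = L / phi q"
    using wt_times_log[OF assms] wt_pos[OF assms] p by (simp add: L_def field_simps)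
  also have "\<dots> = L\<^sup>2 / (L * phi q)"
    using L by (simp add: power2_eq_square)
  also have "\<dots> \<le> (L\<^sup>2 + 2 * L - 1) / (L * phi q)"
    using L p by (intro divide_right_mono) auto
  also have "\<dots> = 2 * (1 + L) / phi q - (1 + L\<^sup>2) / (L * phi q)"
    using L p by (simp add: field_simps power2_eq_square)
  also have "(1 + L\<^sup>2) / (L * phi q) = (1 + q) * ((1 + L\<^sup>2) / (phi q) ^ 3)"
  proof -
    have "(phi q) ^ 3 = (1 + q) * (L * phi q)"
      using phi_square[OF assms] by (simp add: power3_eq_cube power2_eq_square L_def mult.assoc)
    then show ?thesis
      using assms by simp
  qed
  also have "2 * (1 + L) / phi q - \<dots> = 4 * (phi1 q + (1 + q) * phi2 q)"
  proof -
    have "4 * phi1 q = 2 * (1 + L) / phi q"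
    proof -
      have "4 * (a / (2 * b)) = 2 * a / b" for a b :: real by simp
      moreover have "phi1 q = (1 + L) / (2 * phi q)" by (simp add: phi1_def L_def)
      ultimately show ?thesis by (simp only:)
    qed
    moreover have "4 * phi2 q = - ((1 + L\<^sup>2) / (phi q) ^ 3)"
    proof -
      have "4 * (- a / (4 * b)) = - (a / b)" for a b :: real by simp
      moreover have "phi2 q = - (1 + L\<^sup>2) / (4 * (phi q) ^ 3)" by (simp add: phi2_def L_def)
      ultimately show ?thesis by (simp only:)
    qed
    ultimately show ?thesis
      by (simp only: distrib_left mult.left_commute[of 4] mult_minus_right add_uminus_conv_diff)
  qed
  also have "\<dots> \<le> 4 * (phi1 q + q * phi2 q)"
    using phi2_nonpos[OF assms] by (simp add: field_simps)
  finally show ?thesis .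
qed

section \<open>Weighted mean squares of lacunary sums\<close>

lemma young_entropy:
  fixes w v :: real
  assumes "0 < w"
  shows "w * v \<le> w * ln w + exp v"
proof -
  \<comment> \<open>The duality of entropy and exponential comes from 1 + x <= exp x at x = v - ln
    w.\<close>
  have "w * (1 + (v - ln w)) \<le> w * exp (v - ln w)"
    using assms by (intro mult_left_mono exp_ge_add_one_self) auto
  also have "\<dots> = exp v"
    using assms by (simp add: exp_diff)
  finally show ?thesis
    using assms by (simp add: algebra_simps)
qed

text \<open>Once the coefficients are normalised to square sum 1, Young's inequality with exponent
  u^2/4 splits the mean into the entropy of the weight and an exponential mean of at most 12.
  Undoing the quarter and the normalisation gives the factor 4 and the square sum.\<close>

lemma lacunary_weighted_cos:
  fixes r t :: "nat \<Rightarrow> real" and w :: "real \<Rightarrow> real"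
  assumes w: "continuous_on UNIV w" "\<And>x. 0 < w x"
    and E: "circ_avg (\<lambda>x. w x * ln (w x)) \<le> E"
  shows "circ_avg (\<lambda>x. w x * (\<Sum>l<k. r l * cos (3 ^ l * x + t l))\<^sup>2) \<le> 4 * (E + 12) * (\<Sum>l<k. (r l)\<^sup>2)"
proof (cases "(\<Sum>l<k. (r l)\<^sup>2) = 0")
  case True
  then have "\<forall>l\<in>{..<k}. (r l)\<^sup>2 = 0"
    by (subst (asm) sum_nonneg_eq_0_iff) auto
  then have "(\<Sum>l<k. r l * cos (3 ^ l * x + t l)) = 0" for x
    by (intro sum.neutral) auto
  then show ?thesis using True by simp
next
  case False
  define S where "S = (\<Sum>l<k. (r l)\<^sup>2)"
  have S: "0 < S"
    using False sum_nonneg[of "{..<k}" "\<lambda>l. (r l)\<^sup>2"] unfolding S_def by (simp add: less_le)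
  define u where "u = (\<lambda>x. \<Sum>l<k. (r l / sqrt S) * cos (3 ^ l * x + t l))"
  have [continuous_intros]: "continuous_on UNIV u"
    unfolding u_def by (intro continuous_intros)
  note [continuous_intros] = w(1)
  have wne: "w x \<noteq> 0" for x using w(2)[of x] by simp
  have ueq: "(\<Sum>l<k. r l * cos (3 ^ l * x + t l)) = sqrt S * u x" for x
    using S by (simp add: u_def sum_distrib_left)
  have "circ_avg (\<lambda>x. w x * ((u x)\<^sup>2 / 4)) \<le> circ_avg (\<lambda>x. w x * ln (w x) + exp ((u x)\<^sup>2 / 4))"
    by (rule circ_avg_mono) (auto intro!: continuous_intros young_entropy w(2) simp: wne simp del: times_divide_eq_right)
  also have "\<dots> = circ_avg (\<lambda>x. w x * ln (w x)) + circ_avg (\<lambda>x. exp ((u x)\<^sup>2 / 4))"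
    by (rule circ_avg_add) (auto intro!: continuous_intros simp: wne)
  also have "\<dots> \<le> E + 12"
  proof (intro add_mono E)
    have "(\<Sum>l<k. (r l / sqrt S)\<^sup>2) = S / S"
      using S by (simp add: power_divide S_def flip: sum_divide_distrib)
    then show "circ_avg (\<lambda>x. exp ((u x)\<^sup>2 / 4)) \<le> 12"
      unfolding u_def using S by (intro lacunary_exp_square_avg) simp
  qed
  finally have "circ_avg (\<lambda>x. w x * ((u x)\<^sup>2 / 4)) \<le> E + 12" .
  then have "4 * S * circ_avg (\<lambda>x. w x * ((u x)\<^sup>2 / 4)) \<le> 4 * S * (E + 12)"
    using S by (intro mult_left_mono) auto
  moreover have "circ_avg (\<lambda>x. w x * (\<Sum>l<k. r l * cos (3 ^ l * x + t l))\<^sup>2) = 4 * S * circ_avg (\<lambda>x. w x * ((u x)\<^sup>2 / 4))"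
    unfolding ueq circ_avg_mult_left[symmetric] using S by (simp add: power_mult_distrib mult_ac)
  ultimately show ?thesis
    by (simp add: S_def[symmetric] mult_ac)
qed

lemma lacunary_weighted_norm:
  fixes d :: "nat \<Rightarrow> complex" and w :: "real \<Rightarrow> real"
  assumes w: "continuous_on UNIV w" "\<And>x. 0 < w x"
    and E: "circ_avg (\<lambda>x. w x * ln (w x)) \<le> E"
  shows "circ_avg (\<lambda>x. w x * (norm (\<Sum>l<k. d l * cis (- (3 ^ l * x))))\<^sup>2) \<le> 8 * (E + 12) * (\<Sum>l<k. (norm (d l))\<^sup>2)"
proof -
  note [continuous_intros] = w(1)
  \<comment> \<open>The shifts \<open>0\<close> and \<open>pi / 2\<close> give the real and the
    imaginary part as cosine sums. Each costs 4 (E + 12), hence the 8.\<close>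
  let ?c = "\<lambda>t x. \<Sum>l<k. norm (d l) * cos (3 ^ l * x + (t - Arg (d l)))"
  have d: "d l * cis (- y) = of_real (norm (d l)) * cis (Arg (d l) - y)" for l y
    using rcis_cmod_Arg[of "d l"] by (metis cis_mult diff_conv_add_uminus mult.assoc rcis_def)
  have "Re (\<Sum>l<k. d l * cis (- (3 ^ l * x))) = ?c 0 x" for x
    unfolding d Re_sum by (intro sum.cong) (simp_all add: cos_diff cos_add sin_diff sin_add mult.commute)
  moreover have "Im (\<Sum>l<k. d l * cis (- (3 ^ l * x))) = ?c (pi / 2) x" for x
    unfolding d Im_sum by (intro sum.cong) (simp_all add: cos_diff cos_add sin_diff sin_add mult.commute)
  ultimately have "w x * (norm (\<Sum>l<k. d l * cis (- (3 ^ l * x))))\<^sup>2 = w x * (?c 0 x)\<^sup>2 + w x * (?c (pi / 2) x)\<^sup>2" for x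
    unfolding cmod_power2 by (simp only: distrib_left)
  then have "circ_avg (\<lambda>x. w x * (norm (\<Sum>l<k. d l * cis (- (3 ^ l * x))))\<^sup>2) =
     circ_avg (\<lambda>x. w x * (?c 0 x)\<^sup>2) + circ_avg (\<lambda>x. w x * (?c (pi / 2) x)\<^sup>2)"
    by (simp only:) (rule circ_avg_add; intro continuous_intros)
  also have "\<dots> \<le> 4 * (E + 12) * (\<Sum>l<k. (norm (d l))\<^sup>2) + 4 * (E + 12) * (\<Sum>l<k. (norm (d l))\<^sup>2)"
    by (intro add_mono lacunary_weighted_cos assms)
  finally show ?thesis by (simp add: algebra_simps)
qed

text \<open>A discrete form of Taylor's formula, which bounds the integral of |u| J''(u) over
  [-a, 0] by J(0) when J and J' are nonnegative at -a. The mean value theorem picks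
  \<open>s k\<close> between -2/3^k and -1/3^k.\<close>

lemma triadic_second_derivative_sum:
  fixes J J1 J2 :: "real \<Rightarrow> real"
  assumes J: "\<And>u. (J has_real_derivative J1 u) (at u)"
    and J1: "\<And>u. (J1 has_real_derivative J2 u) (at u)"
    and nonneg: "\<And>u. 0 \<le> J u" "\<And>u. u \<le> 0 \<Longrightarrow> 0 \<le> J1 u" "\<And>u. 0 \<le> J2 u"
  obtains s where "\<And>k. - 2 / 3 ^ k \<le> s k" "\<And>k. s k \<le> 0"
    "\<And>K. (\<Sum>k\<le>K. J2 (s k) / 9 ^ k) \<le> J 0"
proof -
  have mono: "J1 u \<le> J1 v" if "u \<le> v" for u v
    using that J1 nonneg(3) by (intro DERIV_nonneg_imp_nondecreasing[of u v J1]) auto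
  have above: "J u + (v - u) * J1 u \<le> J v" if uv: "u < v" for u v
  proof -
    obtain z where z: "u < z" "z < v" "J v - J u = (v - u) * J1 z"
      using MVT2[OF uv, of J J1] J by blast
    have "(v - u) * J1 u \<le> (v - u) * J1 z"
      using z mono[of u z] by (intro mult_left_mono) auto
    with z show ?thesis by linarith
  qed
  \<comment> \<open>The points -3/3^k = -1/3^(k-1) make consecutive intervals abut. Monotonicity of
    \<open>J1\<close> enlarges [-2/3^k, -1/3^k] to [-3/3^k, -1/3^k], and the increments of
    \<open>b\<close> can be summed by parts.\<close>
  define b where "b = (\<lambda>k. J1 (- 3 / 3 ^ k))"
  have "\<exists>s. - 2 / 3 ^ k \<le> s \<and> s \<le> 0 \<and> J2 s / 9 ^ k \<le> (b (Suc k) - b k) / 3 ^ k" for k :: nat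
  proof -
    have "- 2 / 3 ^ k < - 1 / (3::real) ^ k"
      by (simp add: divide_strict_right_mono)
    from MVT2[OF this, of J1 J2] J1 obtain s where s: "- 2 / 3 ^ k < s" "s < - 1 / 3 ^ k"
      "J1 (- 1 / 3 ^ k) - J1 (- 2 / 3 ^ k) = (- 1 / 3 ^ k - - 2 / 3 ^ k) * J2 s"
      by blast
    have "J2 s / 3 ^ k = J1 (- 1 / 3 ^ k) - J1 (- 2 / 3 ^ k)"
      using s(3) by (simp add: diff_divide_distrib[symmetric])
    also have "J1 (- 1 / 3 ^ k) = b (Suc k)"
      by (simp add: b_def)
    also have "b (Suc k) - J1 (- 2 / 3 ^ k) \<le> b (Suc k) - b k"
      unfolding b_def by (intro diff_left_mono mono divide_right_mono) auto
    finally have "J2 s / 3 ^ k / 3 ^ k \<le> (b (Suc k) - b k) / 3 ^ k"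
      by (intro divide_right_mono) auto
    then have "J2 s / 9 ^ k \<le> (b (Suc k) - b k) / 3 ^ k"
      by (simp flip: power_mult_distrib)
    moreover have "s \<le> 0"
      using s(2) by (rule order.strict_implies_order[OF order.strict_trans2]) simp
    ultimately show ?thesis
      using s(1) by (intro exI[of _ s]) auto
  qed
  then obtain s where s: "\<And>k. - 2 / 3 ^ k \<le> s k" "\<And>k. s k \<le> 0"
    "\<And>k. J2 (s k) / 9 ^ k \<le> (b (Suc k) - b k) / 3 ^ k"
    by metis
  \<comment> \<open>Summation by parts as an induction: the drop of the weight on the slope from
    3^-K to 3^-(K+1) is paid for by the growth of \<open>J\<close> above its tangent at
    -1/3^K.\<close>
  have "(\<Sum>k\<le>K. (b (Suc k) - b k) / 3 ^ k) \<le> b (Suc K) / 3 ^ K + J (- 1 / 3 ^ K)" for K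
  proof (induction K)
    case 0
    show ?case
      using nonneg(1)[of "-1"] nonneg(2)[of "-3"] by (simp add: b_def)
  next
    case (Suc K)
    have "J (- 1 / 3 ^ K) + (- 1 / 3 ^ Suc K - - 1 / 3 ^ K) * J1 (- 1 / 3 ^ K) \<le> J (- 1 / 3 ^ Suc K)"
      by (rule above) (simp add: field_simps)
    moreover have "J1 (- 1 / 3 ^ K) = b (Suc K)"
      by (simp add: b_def)
    moreover have "(- 1 / 3 ^ Suc K - - 1 / 3 ^ K) * b (Suc K) = b (Suc K) / 3 ^ K - b (Suc K) / 3 ^ Suc K"
      by (simp add: field_simps)
    ultimately show ?case
      using Suc.IH by (simp add: diff_divide_distrib)
  qed
  moreover have "b (Suc K) / 3 ^ K + J (- 1 / 3 ^ K) \<le> J 0" for K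
    using above[of "- 1 / 3 ^ K" 0] by (simp add: b_def)
  ultimately have "(\<Sum>k\<le>K. J2 (s k) / 9 ^ k) \<le> J 0" for K
    using sum_mono[of "{..K}" "\<lambda>k. J2 (s k) / 9 ^ k", OF s(3)] by (meson order_trans)
  with s that show ?thesis by blast
qed

lemma circ_avg_has_derivative:
  fixes f f' :: "real \<Rightarrow> real \<Rightarrow> real"
  assumes "\<And>u x. ((\<lambda>u. f u x) has_real_derivative f' u x) (at u)"
    and "continuous_on UNIV (\<lambda>z. f (fst z) (snd z))" "continuous_on UNIV (\<lambda>z. f' (fst z) (snd z))"
  shows "((\<lambda>u. circ_avg (f u)) has_real_derivative circ_avg (f' u)) (at u)"
proof -
  have "continuous_on UNIV (f v)" for v
    using continuous_on_compose2[OF assms(2), of UNIV "\<lambda>x. (v, x)"] by (simp add: continuous_on_Pair)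
  then have "f v integrable_on cbox 0 (2 * pi)" for v
    using integrable_on_period[of "f v"] by simp
  moreover have "continuous_on (UNIV \<times> cbox 0 (2 * pi)) (\<lambda>(u, x). f' u x)"
    unfolding case_prod_unfold by (rule continuous_on_subset[OF assms(3)]) simp
  ultimately have "((\<lambda>u. integral (cbox 0 (2 * pi)) (f u)) has_real_derivative integral (cbox 0 (2 * pi)) (f' u)) (at u)"
    using leibniz_rule_field_derivative[of UNIV 0 "2 * pi" f f' u] assms(1) by simp
  then show ?thesis
    unfolding circ_avg_def by (auto intro!: derivative_eq_intros)
qed


lemma norm_sum_mult_cnj_square_le:
  fixes a b :: "'i \<Rightarrow> complex"
  shows "(norm (\<Sum>i\<in>I. a i * cnj (b i)))\<^sup>2 \<le> (\<Sum>i\<in>I. (norm (a i))\<^sup>2) * (\<Sum>i\<in>I. (norm (b i))\<^sup>2)"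
proof -
  have "norm (\<Sum>i\<in>I. a i * cnj (b i)) \<le> (\<Sum>i\<in>I. norm (a i) * norm (b i))"
    by (rule order_trans[OF norm_sum]) (simp add: norm_mult)
  then have "(norm (\<Sum>i\<in>I. a i * cnj (b i)))\<^sup>2 \<le> (\<Sum>i\<in>I. norm (a i) * norm (b i))\<^sup>2"
    by (intro power_mono) auto
  also have "\<dots> \<le> (\<Sum>i\<in>I. (norm (a i))\<^sup>2) * (\<Sum>i\<in>I. (norm (b i))\<^sup>2)"
    by (rule Cauchy_Schwarz_ineq_sum)
  finally show ?thesis .
qed

lemma continuous_on_phi [continuous_intros]:
  assumes "continuous_on S f" "\<And>z. z \<in> S \<Longrightarrow> 0 \<le> f z"
  shows "continuous_on S (\<lambda>z. phi (f z))"
    "continuous_on S (\<lambda>z. phi1 (f z))" "continuous_on S (\<lambda>z. phi2 (f z))" "continuous_on S (\<lambda>z. wt (f z))"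
proof -
  have L: "1 + ln (1 + f z) \<noteq> 0" "1 + f z \<noteq> 0" if "z \<in> S" for z
    using assms(2)[OF that] by (simp_all add: add_nonneg_eq_0_iff)
  show *: "continuous_on S (\<lambda>z. phi (f z))"
    unfolding phi_def using L by (intro continuous_intros assms) auto
  have "phi (f z) \<noteq> 0" if "z \<in> S" for z
    using phi_ge_1[OF assms(2)[OF that]] by simp
  then show "continuous_on S (\<lambda>z. phi1 (f z))" "continuous_on S (\<lambda>z. phi2 (f z))"
    unfolding phi1_def phi2_def using L by (intro continuous_intros assms * ballI; simp)+
  show "continuous_on S (\<lambda>z. wt (f z))"
    unfolding wt_def using L by (intro continuous_intros assms) auto
qed

text \<open>The family of polynomials \<open>\<Sum>\<^sub>n c i n z\<^sup>n\<close> in the logarithmic coordinate \<open>z = exp (u + \<i> x)\<close>;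
  \<open>p d\<close> is its \<open>d\<close>-th derivative with respect to \<open>u + \<i> x\<close>.\<close>

locale polynomial_family =
  fixes I :: "'i set" and c :: "'i \<Rightarrow> nat \<Rightarrow> complex" and N :: nat
  assumes finite_I: "finite I"
begin

definition p :: "nat \<Rightarrow> 'i \<Rightarrow> real \<Rightarrow> real \<Rightarrow> complex" where
  "p d i u x = (\<Sum>n\<le>N. of_nat n ^ d * c i n * (of_real (exp (real n * u)) * cis (real n * x)))"

definition q :: "nat \<Rightarrow> real \<Rightarrow> real \<Rightarrow> real" where
  "q d u x = (\<Sum>i\<in>I. (norm (p d i u x))\<^sup>2)"

definition qu :: "real \<Rightarrow> real \<Rightarrow> real" where
  "qu u x = 2 * Re (\<Sum>i\<in>I. p 1 i u x * cnj (p 0 i u x))"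

text \<open>The derivative of \<open>p 0\<close> in x is i times the one in u, so both partial
  derivatives of \<open>q 0\<close> are read off one inner product.\<close>

definition qx :: "real \<Rightarrow> real \<Rightarrow> real" where
  "qx u x = - 2 * Im (\<Sum>i\<in>I. p 1 i u x * cnj (p 0 i u x))"

text \<open>As \<open>p 0\<close> is holomorphic, its second derivative in x is the negative of the
  one in u. The resulting term in the second derivatives of \<open>q 0\<close> has opposite signs in
  the two directions and cancels in the Laplacian.\<close>

definition h :: "real \<Rightarrow> real \<Rightarrow> real" where
  "h u x = 2 * Re (\<Sum>i\<in>I. p 2 i u x * cnj (p 0 i u x))"

definition J :: "real \<Rightarrow> real" where
  "J u = circ_avg (\<lambda>x. phi (q 0 u x))"

definition J1 :: "real \<Rightarrow> real" where
  "J1 u = circ_avg (\<lambda>x. phi1 (q 0 u x) * qu u x)"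

definition J2 :: "real \<Rightarrow> real" where
  "J2 u = circ_avg (\<lambda>x. phi2 (q 0 u x) * (qu u x)\<^sup>2 + phi1 (q 0 u x) * (2 * q 1 u x + h u x))"

lemma q_nonneg: "0 \<le> q d u x"
  by (auto simp: q_def intro!: sum_nonneg)

lemma continuous_on_p [continuous_intros]:
  "continuous_on S f \<Longrightarrow> continuous_on S g \<Longrightarrow> continuous_on S (\<lambda>z. p d i (f z) (g z))"
  unfolding p_def by (intro continuous_intros)

lemma continuous_on_q [continuous_intros]:
  "continuous_on S f \<Longrightarrow> continuous_on S g \<Longrightarrow> continuous_on S (\<lambda>z. q d (f z) (g z))"
  unfolding q_def by (intro continuous_intros)

lemma continuous_on_qu [continuous_intros]:
  "continuous_on S f \<Longrightarrow> continuous_on S g \<Longrightarrow> continuous_on S (\<lambda>z. qu (f z) (g z))"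
  unfolding qu_def by (intro continuous_intros)

lemma continuous_on_qx [continuous_intros]:
  "continuous_on S f \<Longrightarrow> continuous_on S g \<Longrightarrow> continuous_on S (\<lambda>z. qx (f z) (g z))"
  unfolding qx_def by (intro continuous_intros)

lemma continuous_on_h [continuous_intros]:
  "continuous_on S f \<Longrightarrow> continuous_on S g \<Longrightarrow> continuous_on S (\<lambda>z. h (f z) (g z))"
  unfolding h_def by (intro continuous_intros)

lemma p_derivative_u: "((\<lambda>u. p d i u x) has_vector_derivative p (Suc d) i u x) (at u within S)"
proof -
  have "((\<lambda>u. complex_of_real (exp (real n * u))) has_vector_derivative of_nat n * of_real (exp (real n * u))) (at u within S)" for n
    by (rule has_vector_derivative_eq_rhs, rule has_vector_derivative_of_real)
       (auto intro!: derivative_eq_intros simp: has_real_derivative_iff_has_vector_derivative[symmetric])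
  then show ?thesis
    unfolding p_def
    by (auto intro!: derivative_eq_intros sum.cong simp: algebra_simps)
qed

lemma p_derivative_x: "((\<lambda>x. p d i u x) has_vector_derivative \<i> * p (Suc d) i u x) (at x within S)"
proof -
  have "((\<lambda>x. cis (real n * x)) has_vector_derivative \<i> * of_nat n * cis (real n * x)) (at x within S)" for n
  proof -
    have "((\<lambda>z. exp (\<i> * of_nat n * z)) has_field_derivative \<i> * of_nat n * cis (real n * x)) (at (of_real x))"
      by (auto simp: cis_conv_exp mult.assoc intro!: derivative_eq_intros)
    from has_vector_derivative_real_field[OF this, of S] show ?thesis
      by (simp add: cis_conv_exp mult.assoc)
  qed
  then show ?thesis
    unfolding p_def
    by (auto intro!: derivative_eq_intros sum.cong simp: sum_distrib_left algebra_simps)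
qed

lemma has_vector_derivative_sum_mult_cnj:
  assumes "\<And>i. i \<in> I \<Longrightarrow> (f i has_vector_derivative f' i) (at x within S)"
    "\<And>i. i \<in> I \<Longrightarrow> (g i has_vector_derivative g' i) (at x within S)"
  shows "((\<lambda>x. \<Sum>i\<in>I. f i x * cnj (g i x)) has_vector_derivative
      (\<Sum>i\<in>I. f' i * cnj (g i x) + f i x * cnj (g' i))) (at x within S)"
  by (auto intro!: derivative_eq_intros assms bounded_linear.has_vector_derivative[OF bounded_linear_cnj] simp: add.commute)


lemma q_eq_Re: "q d u x = Re (\<Sum>i\<in>I. p d i u x * cnj (p d i u x))"
  by (simp only: q_def Re_sum complex_norm_square[symmetric] Re_complex_of_real)

lemma q_derivative_u: "((\<lambda>u. q 0 u x) has_real_derivative qu u x) (at u)"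
proof -
  have "qu u x = Re (\<Sum>i\<in>I. p (Suc 0) i u x * cnj (p 0 i u x) + p 0 i u x * cnj (p (Suc 0) i u x))"
    unfolding qu_def Re_sum sum_distrib_left by (rule sum.cong) simp_all
  then show ?thesis
    unfolding q_eq_Re has_real_derivative_iff_has_vector_derivative
    by (simp only:)
       (intro bounded_linear.has_vector_derivative[OF bounded_linear_Re] has_vector_derivative_sum_mult_cnj p_derivative_u)
qed

lemma q_derivative_x: "((\<lambda>x. q 0 u x) has_real_derivative qx u x) (at x within S)"
proof -
  have "qx u x = Re (\<Sum>i\<in>I. (\<i> * p (Suc 0) i u x) * cnj (p 0 i u x) + p 0 i u x * cnj (\<i> * p (Suc 0) i u x))"
    unfolding qx_def Re_sum Im_sum sum_distrib_left by (rule sum.cong) simp_all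
  then show ?thesis
    unfolding q_eq_Re has_real_derivative_iff_has_vector_derivative
    by (simp only:)
       (intro bounded_linear.has_vector_derivative[OF bounded_linear_Re] has_vector_derivative_sum_mult_cnj p_derivative_x)
qed

lemma qu_derivative_u: "((\<lambda>u. qu u x) has_real_derivative 2 * q 1 u x + h u x) (at u)"
proof -
  have "2 * q 1 u x + h u x = 2 * Re (\<Sum>i\<in>I. p (Suc 1) i u x * cnj (p 0 i u x) + p 1 i u x * cnj (p (Suc 0) i u x))"
    by (simp add: q_eq_Re h_def sum.distrib numeral_2_eq_2)
  moreover have "((\<lambda>u. Re (\<Sum>i\<in>I. p 1 i u x * cnj (p 0 i u x))) has_real_derivative
     Re (\<Sum>i\<in>I. p (Suc 1) i u x * cnj (p 0 i u x) + p 1 i u x * cnj (p (Suc 0) i u x))) (at u)"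
    unfolding has_real_derivative_iff_has_vector_derivative
    by (intro bounded_linear.has_vector_derivative[OF bounded_linear_Re] has_vector_derivative_sum_mult_cnj p_derivative_u)
  ultimately show ?thesis
    unfolding qu_def using DERIV_cmult by (simp only:)
qed

lemma qx_derivative_x: "((\<lambda>x. qx u x) has_real_derivative 2 * q 1 u x - h u x) (at x within S)"
proof -
  have "2 * q 1 u x - h u x = - 2 * Im (\<Sum>i\<in>I. (\<i> * p (Suc 1) i u x) * cnj (p 0 i u x) + p 1 i u x * cnj (\<i> * p (Suc 0) i u x))"
    unfolding q_eq_Re h_def Re_sum Im_sum sum_distrib_left sum_subtractf[symmetric] numeral_2_eq_2 One_nat_def
    by (rule sum.cong) (simp_all add: algebra_simps)
  moreover have "((\<lambda>x. Im (\<Sum>i\<in>I. p 1 i u x * cnj (p 0 i u x))) has_real_derivative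
     Im (\<Sum>i\<in>I. (\<i> * p (Suc 1) i u x) * cnj (p 0 i u x) + p 1 i u x * cnj (\<i> * p (Suc 0) i u x))) (at x within S)"
    unfolding has_real_derivative_iff_has_vector_derivative
    by (intro bounded_linear.has_vector_derivative[OF bounded_linear_Im] has_vector_derivative_sum_mult_cnj p_derivative_x)
  ultimately show ?thesis
    unfolding qx_def using DERIV_cmult by (simp only:)
qed

text \<open>Up to sign, the two partial derivatives are twice the real and the imaginary part of one
  inner product, so one Cauchy-Schwarz inequality bounds the whole gradient. Bounding them
  separately would lose a factor 2, enough to cancel the leading term in
  \<open>phi1_phi2_ge\<close>.\<close>

lemma qu_qx_le: "(qu u x)\<^sup>2 + (qx u x)\<^sup>2 \<le> 4 * (q 1 u x * q 0 u x)"
proof -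
  have "(qu u x)\<^sup>2 + (qx u x)\<^sup>2 = 4 * (norm (\<Sum>i\<in>I. p 1 i u x * cnj (p 0 i u x)))\<^sup>2"
    unfolding qu_def qx_def cmod_power2 by (simp add: power_mult_distrib)
  also have "\<dots> \<le> 4 * (q 1 u x * q 0 u x)"
    unfolding q_def by (intro mult_left_mono norm_sum_mult_cnj_square_le) auto
  finally show ?thesis .
qed

lemma J_derivative: "(J has_real_derivative J1 u) (at u)"
  unfolding J_def J1_def
  by (rule circ_avg_has_derivative)
     (auto intro!: DERIV_chain2[OF phi_has_derivative] q_derivative_u continuous_intros q_nonneg)

lemma J1_derivative: "(J1 has_real_derivative J2 u) (at u)"
  unfolding J1_def J2_def
proof (rule circ_avg_has_derivative)
  fix u x
  show "((\<lambda>u. phi1 (q 0 u x) * qu u x) has_real_derivative phi2 (q 0 u x) * (qu u x)\<^sup>2 + phi1 (q 0 u x) * (2 * q 1 u x + h u x)) (at u)"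
    by (rule DERIV_cong, rule DERIV_mult[OF DERIV_chain2[OF phi1_has_derivative[OF q_nonneg] q_derivative_u] qu_derivative_u])
       (simp add: power2_eq_square)
qed (intro continuous_intros q_nonneg)+

text \<open>Integrating the second derivative in \<open>x\<close> over a period gives \<open>0\<close>, so that it may be added to the
  second derivative in \<open>u\<close> to form the Laplacian.\<close>

lemma circ_avg_second_derivative_x:
  "circ_avg (\<lambda>x. phi2 (q 0 u x) * (qx u x)\<^sup>2 + phi1 (q 0 u x) * (2 * q 1 u x - h u x)) = 0"
proof -
  define F where "F = (\<lambda>x. phi1 (q 0 u x) * qx u x)"
  have "(F has_real_derivative phi2 (q 0 u x) * (qx u x)\<^sup>2 + phi1 (q 0 u x) * (2 * q 1 u x - h u x)) (at x within {0..2 * pi})" for x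
    unfolding F_def
    by (rule DERIV_cong, rule DERIV_mult[OF DERIV_chain2[OF phi1_has_derivative[OF q_nonneg] q_derivative_x] qx_derivative_x])
       (simp add: power2_eq_square)
  then have "((\<lambda>x. phi2 (q 0 u x) * (qx u x)\<^sup>2 + phi1 (q 0 u x) * (2 * q 1 u x - h u x)) has_integral (F (2 * pi) - F 0)) {0..2 * pi}"
    by (intro fundamental_theorem_of_calculus) (auto simp: has_real_derivative_iff_has_vector_derivative)
  moreover have "p d i u (2 * pi) = p d i u 0" for d i
    unfolding p_def using cis_multiple_2pi[of "real _"] by (simp add: mult_ac)
  then have "F (2 * pi) = F 0"
    by (simp add: F_def q_def qx_def)
  ultimately show ?thesis
    by (simp add: circ_avg_def integral_unique)
qed

text \<open>Adding the vanishing mean of the second derivative in x produces the Laplacian phi2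
  |grad q|^2 + 4 phi1 |p'|^2, from which \<open>h\<close> has disappeared. As \<open>phi2\<close> is
  nonpositive, the worst case is equality in Cauchy-Schwarz, and \<open>phi1_phi2_ge\<close>
  evaluates it.\<close>

lemma J2_ge: "circ_avg (\<lambda>x. q 1 u x / wt (q 0 u x)) \<le> J2 u"
proof -
  have "q 1 u x / wt (q 0 u x) \<le> (phi2 (q 0 u x) * (qu u x)\<^sup>2 + phi1 (q 0 u x) * (2 * q 1 u x + h u x))
      + (phi2 (q 0 u x) * (qx u x)\<^sup>2 + phi1 (q 0 u x) * (2 * q 1 u x - h u x))" for x
  proof -
    have "q 1 u x / wt (q 0 u x) = q 1 u x * (1 / wt (q 0 u x))"
      by simp
    also have "\<dots> \<le> q 1 u x * (4 * (phi1 (q 0 u x) + q 0 u x * phi2 (q 0 u x)))"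
      by (intro mult_left_mono phi1_phi2_ge q_nonneg)
    also have "\<dots> = phi2 (q 0 u x) * (4 * (q 1 u x * q 0 u x)) + phi1 (q 0 u x) * (4 * q 1 u x)"
      by (simp add: algebra_simps)
    also have "\<dots> \<le> phi2 (q 0 u x) * ((qu u x)\<^sup>2 + (qx u x)\<^sup>2) + phi1 (q 0 u x) * (4 * q 1 u x)"
      by (intro add_right_mono mult_left_mono_neg qu_qx_le phi2_nonpos q_nonneg)
    finally show ?thesis
      by (simp add: algebra_simps)
  qed
  then have "circ_avg (\<lambda>x. q 1 u x / wt (q 0 u x)) \<le> circ_avg (\<lambda>x. (phi2 (q 0 u x) * (qu u x)\<^sup>2 + phi1 (q 0 u x) * (2 * q 1 u x + h u x))
      + (phi2 (q 0 u x) * (qx u x)\<^sup>2 + phi1 (q 0 u x) * (2 * q 1 u x - h u x)))"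
    using wt_pos[OF q_nonneg] by (intro circ_avg_mono continuous_intros q_nonneg ballI) (auto simp: less_imp_neq[symmetric])
  also have "\<dots> = J2 u + circ_avg (\<lambda>x. phi2 (q 0 u x) * (qx u x)\<^sup>2 + phi1 (q 0 u x) * (2 * q 1 u x - h u x))"
    unfolding J2_def by (intro circ_avg_add continuous_intros q_nonneg)
  finally show ?thesis
    unfolding circ_avg_second_derivative_x by simp
qed


lemma J_ge_1: "1 \<le> J u"
proof -
  have "circ_avg (\<lambda>x. 1) \<le> J u"
    unfolding J_def by (intro circ_avg_mono continuous_intros q_nonneg phi_ge_1)
  then show ?thesis by simp
qed

lemma J2_nonneg: "0 \<le> J2 u"
proof -
  have "circ_avg (\<lambda>x. 0) \<le> circ_avg (\<lambda>x. q 1 u x / wt (q 0 u x))"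
    using wt_pos[OF q_nonneg]
    by (intro circ_avg_mono continuous_intros q_nonneg ballI divide_nonneg_pos) (auto simp: less_imp_neq[symmetric])
  then show ?thesis
    using J2_ge[of u] by simp
qed

text \<open>Here the absence of negative frequencies enters: exp (n u) <= 1 for u <= 0.\<close>

lemma J_bounded: "\<exists>M. \<forall>u\<le>0. J u \<le> M"
proof (intro exI allI impI)
  define Q where "Q = (\<Sum>i\<in>I. (\<Sum>n\<le>N. norm (c i n))\<^sup>2)"
  fix u :: real assume u: "u \<le> 0"
  have "norm (p 0 i u x) \<le> (\<Sum>n\<le>N. norm (c i n))" for i x
    unfolding p_def
  proof (rule sum_norm_le)
    fix n
    have "exp (real n * u) \<le> 1"
      using u by (simp add: mult_nonneg_nonpos)
    then show "norm (of_nat n ^ 0 * c i n * (complex_of_real (exp (real n * u)) * cis (real n * x))) \<le> norm (c i n)"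
      by (simp add: norm_mult mult_left_le)
  qed
  then have "q 0 u x \<le> Q" for x
    unfolding q_def Q_def by (intro sum_mono power_mono) auto
  then have "J u \<le> circ_avg (\<lambda>x. phi Q)"
    unfolding J_def by (intro circ_avg_mono continuous_intros q_nonneg phi_mono)
  then show "J u \<le> phi (\<Sum>i\<in>I. (\<Sum>n\<le>N. norm (c i n))\<^sup>2)"
    by (simp add: Q_def)
qed

text \<open>A convex function with negative slope at \<open>u\<close> lies above a line that grows
  without bound to the left, against \<open>J_bounded\<close>.\<close>

lemma J1_nonneg:
  assumes "u \<le> 0"
  shows "0 \<le> J1 u"
proof (rule ccontr)
  assume neg: "\<not> 0 \<le> J1 u"
  obtain M where M: "\<And>u. u \<le> 0 \<Longrightarrow> J u \<le> M"
    using J_bounded by blast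
  have mono: "J1 v \<le> J1 v'" if "v \<le> v'" for v v'
    using that J1_derivative J2_nonneg by (intro DERIV_nonneg_imp_nondecreasing[of v v' J1]) auto
  \<comment> \<open>Far enough to the left for the tangent at \<open>u\<close> to have risen by 1 +
    |M|.\<close>
  define v where "v = u - (1 + \<bar>M\<bar>) / (- J1 u)"
  have "v < u"
    unfolding v_def using neg by (simp add: divide_pos_neg)
  from MVT2[OF this, of J J1] J_derivative obtain z where z: "z < u" "J u - J v = (u - v) * J1 z"
    by blast
  have "(u - v) * J1 z \<le> (u - v) * J1 u"
    using mono[of z u] z \<open>v < u\<close> by (intro mult_left_mono) auto
  also have "\<dots> = - (1 + \<bar>M\<bar>)"
    unfolding v_def using neg by simp
  finally have "J u + 1 + \<bar>M\<bar> \<le> J v"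
    using z by simp
  then show False
    using M[of v] J_ge_1[of u] \<open>v < u\<close> assms by linarith
qed

lemma J_mono:
  assumes "u \<le> 0" shows "J u \<le> J 0"
  using assms J_derivative J1_nonneg by (intro DERIV_nonneg_imp_nondecreasing[of u 0 J]) auto

section \<open>Coefficients of one block, and summation over the blocks\<close>

lemma circ_avg_p_cis:
  assumes "m \<le> N"
  shows "circ_avg (\<lambda>x. p 1 i u x * cis (- (real m * x))) = of_nat m * c i m * of_real (exp (real m * u))"
proof -
  have "p 1 i u x * cis (- (real m * x)) =
      (\<Sum>n\<le>N. (of_nat n * c i n * of_real (exp (real n * u))) * cis (of_int (int n - int m) * x))" for x
    unfolding p_def sum_distrib_right
    by (intro sum.cong) (simp_all add: cis_mult algebra_simps)
  then have "circ_avg (\<lambda>x. p 1 i u x * cis (- (real m * x))) =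
      (\<Sum>n\<le>N. of_nat n * c i n * of_real (exp (real n * u)) * (if n = m then 1 else 0))"
    by (simp only: circ_avg_mult_left circ_avg_cis circ_avg_sum[OF finite_atMost] continuous_intros) auto
  also have "\<dots> = of_nat m * c i m * of_real (exp (real m * u))"
    using assms by (simp add: if_distrib cong: if_cong)
  finally show ?thesis .
qed

text \<open>The test function \<open>g\<close> takes its coefficients \<open>d\<close> from p'
  itself, so its pairing with p' is the very sum to be bounded. That sum reappears on the right,
  through the cost of \<open>g\<close>, with factor 1/2 and is absorbed.\<close>

lemma block_bound:
  assumes k: "3 ^ k \<le> N" and u: "u \<le> 0"
  defines "m \<equiv> (\<lambda>l. 3 ^ k - 3 ^ l :: nat)"
  defines "d \<equiv> (\<lambda>i l. of_nat (m l) * c i (m l) * of_real (exp (real (m l) * u)))"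
  shows "(\<Sum>i\<in>I. \<Sum>l<k. (norm (d i l))\<^sup>2) \<le> 100 * J 0 * J2 u"
proof -
  define D where "D = (\<Sum>i\<in>I. \<Sum>l<k. (norm (d i l))\<^sup>2)"
  define w where "w = (\<lambda>x. wt (q 0 u x))"
  define g where "g = (\<lambda>i x. \<Sum>l<k. d i l * cis (real (m l) * x))"
  \<comment> \<open>The constant of \<open>lacunary_weighted_norm\<close> for entropy at most
    \<open>J u / 2\<close>. It equals 4 J + 96, which is at most 100 J because J >= 1.\<close>
  define K where "K = 8 * (J u / 2 + 12)"
  have K: "0 < K" "K \<le> 100 * J 0"
    using J_ge_1[of u] J_mono[OF u] by (simp_all add: K_def)
  have w: "continuous_on UNIV w" "0 < w x" for x
    unfolding w_def by (intro continuous_intros q_nonneg wt_pos)+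
  note [continuous_intros] = w(1)
  have wne: "w x \<noteq> 0" for x using w(2)[of x] by simp
  have J2w: "circ_avg (\<lambda>x. q 1 u x / w x) \<le> J2 u"
    unfolding w_def by (rule J2_ge)
  have g [continuous_intros]: "continuous_on UNIV (g i)" for i
    unfolding g_def by (intro continuous_intros)
  have mN: "m l \<le> N" for l
    using k unfolding m_def by (meson diff_le_self order_trans)
  have "circ_avg (\<lambda>x. w x * ln (w x)) \<le> circ_avg (\<lambda>x. 1 / 2 * phi (q 0 u x))"
    using wt_ln_wt_le[OF q_nonneg] by (intro circ_avg_mono continuous_intros q_nonneg ballI) (auto simp: w_def wne[unfolded w_def])
  also have "\<dots> = J u / 2"
    unfolding circ_avg_mult_left J_def by simp
  finally have entropy: "circ_avg (\<lambda>x. w x * ln (w x)) \<le> J u / 2" .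
  have wg: "circ_avg (\<lambda>x. w x * (norm (g i x))\<^sup>2) \<le> K * (\<Sum>l<k. (norm (d i l))\<^sup>2)" for i
  proof -
    have "g i x = cis (3 ^ k * x) * (\<Sum>l<k. d i l * cis (- (3 ^ l * x)))" for x
      unfolding g_def sum_distrib_left
    proof (intro sum.cong refl)
      fix l assume "l \<in> {..<k}"
      then have "real (m l) = 3 ^ k - 3 ^ l"
        unfolding m_def by (simp add: of_nat_diff power_increasing)
      then show "d i l * cis (real (m l) * x) = cis (3 ^ k * x) * (d i l * cis (- (3 ^ l * x)))"
        by (simp add: cis_mult mult.left_commute left_diff_distrib)
    qed
    then have "norm (g i x) = norm (\<Sum>l<k. d i l * cis (- (3 ^ l * x)))" for x
      by (simp add: norm_mult)
    then show ?thesis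
      unfolding K_def using lacunary_weighted_norm[OF w entropy] by simp
  qed
  have orth: "circ_avg (\<lambda>x. Re (p 1 i u x * cnj (g i x))) = (\<Sum>l<k. (norm (d i l))\<^sup>2)" for i
  proof -
    have "p 1 i u x * cnj (g i x) = (\<Sum>l<k. cnj (d i l) * (p 1 i u x * cis (- (real (m l) * x))))" for x
      unfolding g_def cnj_sum sum_distrib_left by (intro sum.cong) (simp_all add: cis_cnj)
    then have "circ_avg (\<lambda>x. p 1 i u x * cnj (g i x)) = (\<Sum>l<k. cnj (d i l) * d i l)"
      by (simp only: circ_avg_sum[OF finite_lessThan] continuous_intros circ_avg_mult_left circ_avg_p_cis[OF mN] d_def)
    also have "\<dots> = of_real (\<Sum>l<k. (norm (d i l))\<^sup>2)"
      by (simp only: complex_norm_square of_real_sum mult.commute)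
    finally show ?thesis
      using circ_avg_Re[of "\<lambda>x. p 1 i u x * cnj (g i x)"] by (simp add: continuous_intros)
  qed
  have "D = circ_avg (\<lambda>x. \<Sum>i\<in>I. Re (p 1 i u x * cnj (g i x)))"
    unfolding D_def orth[symmetric] by (intro circ_avg_sum[symmetric] finite_I continuous_intros)
  also have "\<dots> \<le> circ_avg (\<lambda>x. K / 2 * (q 1 u x / w x) + 1 / (2 * K) * (\<Sum>i\<in>I. w x * (norm (g i x))\<^sup>2))"
  proof (rule circ_avg_mono)
    fix x
    \<comment> \<open>The parameter \<open>K\<close> balances the two squares: since the weighted
      mean of |g|^2 costs \<open>K\<close> times the square sum of \<open>d\<close>, the second term
      contributes at most half of \<open>D\<close>.\<close>
    have "Re (p 1 i u x * cnj (g i x)) \<le> K / 2 * ((norm (p 1 i u x))\<^sup>2 / w x) + 1 / (2 * K) * (w x * (norm (g i x))\<^sup>2)" for i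
    proof -
      have "0 \<le> (K * norm (p 1 i u x) - w x * norm (g i x))\<^sup>2 / (2 * K * w x)"
        using K w(2)[of x] by simp
      also have "\<dots> = K / 2 * ((norm (p 1 i u x))\<^sup>2 / w x) + 1 / (2 * K) * (w x * (norm (g i x))\<^sup>2) - norm (p 1 i u x) * norm (g i x)"
        using K w(2)[of x] by (simp add: power2_eq_square field_simps)
      finally show ?thesis
        using complex_Re_le_cmod[of "p 1 i u x * cnj (g i x)"] by (simp add: norm_mult)
    qed
    then have "(\<Sum>i\<in>I. Re (p 1 i u x * cnj (g i x))) \<le>
      (\<Sum>i\<in>I. K / 2 * ((norm (p 1 i u x))\<^sup>2 / w x) + 1 / (2 * K) * (w x * (norm (g i x))\<^sup>2))"
      by (rule sum_mono)
    also have "\<dots> = K / 2 * (q 1 u x / w x) + 1 / (2 * K) * (\<Sum>i\<in>I. w x * (norm (g i x))\<^sup>2)"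
      unfolding q_def sum.distrib sum_distrib_left sum_divide_distrib by simp
    finally show "(\<Sum>i\<in>I. Re (p 1 i u x * cnj (g i x))) \<le> \<dots>" .
  qed (intro continuous_intros; simp add: wne)+
  also have "\<dots> = K / 2 * circ_avg (\<lambda>x. q 1 u x / w x) + 1 / (2 * K) * (\<Sum>i\<in>I. circ_avg (\<lambda>x. w x * (norm (g i x))\<^sup>2))"
    by (subst circ_avg_add, (intro continuous_intros; simp add: wne), intro continuous_intros,
        subst circ_avg_mult_left, subst circ_avg_mult_left, subst circ_avg_sum)
       (intro finite_I continuous_intros refl)+
  also have "\<dots> \<le> K / 2 * J2 u + 1 / (2 * K) * (\<Sum>i\<in>I. K * (\<Sum>l<k. (norm (d i l))\<^sup>2))"
    using K J2w by (intro add_mono mult_left_mono sum_mono wg) auto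
  also have "\<dots> = K / 2 * J2 u + D / 2"
    unfolding D_def sum_distrib_left[symmetric] using K by simp
  finally have "D \<le> K * J2 u"
    by simp
  also have "\<dots> \<le> 100 * J 0 * J2 u"
    by (intro mult_right_mono K J2_nonneg)
  finally show ?thesis
    unfolding D_def .
qed

text \<open>The frequencies m of the block lie between (2/3) 3^k and 3^k, so the derivative gains at
  least (2/3) 3^k, while exp (m u) >= e^-2 for these \<open>u\<close>. Squaring gives the factor
  (9/4) e^4 / 9^k, and the 100 of \<open>block_bound\<close> makes it 225 e^4 / 9^k.\<close>

lemma block_coefficients:
  assumes k: "3 ^ k \<le> N" and u: "u \<le> 0" "- 2 / 3 ^ k \<le> u"
  shows "(\<Sum>i\<in>I. \<Sum>l<k. (norm (c i (3 ^ k - 3 ^ l)))\<^sup>2) \<le> 225 * exp 4 * J 0 * (J2 u / 9 ^ k)"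
proof -
  have *: "(norm (c i (3 ^ k - 3 ^ l)))\<^sup>2 \<le> 9 / 4 * exp 4 / 9 ^ k *
     (norm (of_nat (3 ^ k - 3 ^ l) * c i (3 ^ k - 3 ^ l) * of_real (exp (real (3 ^ k - 3 ^ l) * u))))\<^sup>2" if "l < k" for i l
  proof -
    define m :: nat where "m = 3 ^ k - 3 ^ l"
    have "3 * (3::real) ^ l \<le> 3 ^ k"
      using that power_increasing[of "Suc l" k "3::real"] by simp
    then have m: "2 / 3 * 3 ^ k \<le> real m" "real m \<le> 3 ^ k"
      using that by (simp_all add: m_def of_nat_diff power_increasing)
    have "- 2 = 3 ^ k * (- 2 / 3 ^ k :: real)"
      by simp
    also have "\<dots> \<le> 3 ^ k * u"
      using u by (intro mult_left_mono) auto
    also have "\<dots> \<le> real m * u"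
      using u m by (intro mult_right_mono_neg) auto
    finally have "exp (- 2) \<le> exp (real m * u)"
      by simp
    then have "2 / 3 * 3 ^ k * norm (c i m) * exp (- 2) \<le> real m * norm (c i m) * exp (real m * u)"
      using m by (intro mult_mono) auto
    also have "\<dots> = norm (of_nat m * c i m * of_real (exp (real m * u)))"
      by (simp add: norm_mult)
    finally have "(2 / 3 * 3 ^ k * norm (c i m) * exp (- 2))\<^sup>2 \<le> (norm (of_nat m * c i m * of_real (exp (real m * u))))\<^sup>2"
      by (intro power_mono) auto
    then have "9 / 4 * exp 4 / 9 ^ k * (2 / 3 * 3 ^ k * norm (c i m) * exp (- 2))\<^sup>2 \<le> 9 / 4 * exp 4 / 9 ^ k * (norm (of_nat m * c i m * of_real (exp (real m * u))))\<^sup>2"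
      by (intro mult_left_mono) auto
    moreover have "9 / 4 * exp 4 / 9 ^ k * (2 / 3 * 3 ^ k * norm (c i m) * exp (- 2))\<^sup>2 = (norm (c i m))\<^sup>2"
    proof -
      have "((3::real) ^ k)\<^sup>2 = 9 ^ k" "(exp (- 2 :: real))\<^sup>2 = inverse (exp 4)"
        by (simp_all add: power2_eq_square flip: power_mult_distrib exp_add exp_minus)
      then show ?thesis
        by (simp add: power_mult_distrib power_divide)
    qed
    ultimately show ?thesis
      unfolding m_def by simp
  qed
  then have "(\<Sum>i\<in>I. \<Sum>l<k. (norm (c i (3 ^ k - 3 ^ l)))\<^sup>2) \<le> (\<Sum>i\<in>I. \<Sum>l<k. 9 / 4 * exp 4 / 9 ^ k *
     (norm (of_nat (3 ^ k - 3 ^ l) * c i (3 ^ k - 3 ^ l) * of_real (exp (real (3 ^ k - 3 ^ l) * u))))\<^sup>2)"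
    by (intro sum_mono) auto
  also have "\<dots> \<le> 9 / 4 * exp 4 / 9 ^ k * (100 * J 0 * J2 u)"
    unfolding sum_distrib_left[symmetric] by (intro mult_left_mono block_bound[OF k u(1)]) auto
  finally show ?thesis by (simp add: mult_ac)
qed

text \<open>\<open>J 0\<close> enters twice, as the cost of pairing in each block and as the bound
  for the weighted sum of the \<open>J2 (s k)\<close>; hence the square.\<close>

lemma coefficient_bound:
  assumes K: "3 ^ K \<le> N"
  shows "(\<Sum>i\<in>I. \<Sum>k\<le>K. \<Sum>l<k. (norm (c i (3 ^ k - 3 ^ l)))\<^sup>2) \<le> 225 * exp 4 * (J 0)\<^sup>2"
proof -
  obtain s where s: "\<And>k. - 2 / 3 ^ k \<le> s k" "\<And>k. s k \<le> 0" "\<And>K. (\<Sum>k\<le>K. J2 (s k) / 9 ^ k) \<le> J 0"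
    using triadic_second_derivative_sum[OF J_derivative J1_derivative order_trans[OF zero_le_one J_ge_1] J1_nonneg J2_nonneg]
    by blast
  have "(\<Sum>i\<in>I. \<Sum>k\<le>K. \<Sum>l<k. (norm (c i (3 ^ k - 3 ^ l)))\<^sup>2) = (\<Sum>k\<le>K. \<Sum>i\<in>I. \<Sum>l<k. (norm (c i (3 ^ k - 3 ^ l)))\<^sup>2)"
    by (rule sum.swap)
  also have "\<dots> \<le> (\<Sum>k\<le>K. 225 * exp 4 * J 0 * (J2 (s k) / 9 ^ k))"
  proof (rule sum_mono)
    fix k assume "k \<in> {..K}"
    then have "3 ^ k \<le> (3::nat) ^ K"
      by (intro power_increasing) auto
    then have "3 ^ k \<le> N"
      using K by linarith
    then show "(\<Sum>i\<in>I. \<Sum>l<k. (norm (c i (3 ^ k - 3 ^ l)))\<^sup>2) \<le> 225 * exp 4 * J 0 * (J2 (s k) / 9 ^ k)"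
      by (rule block_coefficients[OF _ s(2,1)])
  qed
  also have "\<dots> \<le> 225 * exp 4 * J 0 * J 0"
    unfolding sum_distrib_left[symmetric] using J_ge_1[of 0] s(3)[of K] by (intro mult_left_mono) auto
  finally show ?thesis by (simp add: power2_eq_square)
qed

end

lemma lacunary_difference_coefficients_le:
  fixes c :: "'i \<Rightarrow> nat \<Rightarrow> complex"
  assumes "finite I" "3 ^ K \<le> N"
  shows "(\<Sum>i\<in>I. \<Sum>k\<le>K. \<Sum>l<k. (norm (c i (3 ^ k - 3 ^ l)))\<^sup>2)
    \<le> 225 * exp 4 * (circ_avg (\<lambda>x. phi (\<Sum>i\<in>I. (norm (\<Sum>n\<le>N. c i n * cis (real n * x)))\<^sup>2)))\<^sup>2"
proof -
  interpret polynomial_family I c N by standard fact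
  show ?thesis
    using coefficient_bound[OF assms(2)] by (simp add: J_def q_def p_def)
qed

section \<open>Polynomials in two variables\<close>

text \<open>\<open>Theta\<close> is a convex majorant, up to constants, of \<open>s \<mapsto> phi (s\<^sup>2)\<close> on \<open>[1, \<infinity>)\<close>.\<close>

definition Theta :: "real \<Rightarrow> real" where
  "Theta s = s * sqrt (1 + ln s)"

text \<open>The integrand of L log L, in which the two nested square roots of logarithms end up by
  \<open>Theta_phi_le\<close>.\<close>

definition Omega :: "real \<Rightarrow> real" where
  "Omega s = (1 + s) * (1 + ln (1 + s))"

text \<open>Convexity on a half-line in the form of supporting lines, through which Jensen's
  inequality is applied to circle averages and to the Fejer kernel.\<close>

lemma tangent_below:
  fixes f f' :: "real \<Rightarrow> real"
  assumes deriv: "\<And>s. a \<le> s \<Longrightarrow> (f has_real_derivative f' s) (at s)"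
    and mono: "\<And>s t. a \<le> s \<Longrightarrow> s \<le> t \<Longrightarrow> f' s \<le> f' t"
    and m: "a \<le> m" and s: "a \<le> s"
  shows "f m + f' m * (s - m) \<le> f s"
proof (cases s m rule: linorder_cases)
  case less
  from MVT2[OF this, of f f'] deriv s obtain z where z: "s < z" "z < m" "f m - f s = (m - s) * f' z"
    by force
  have "(m - s) * f' z \<le> (m - s) * f' m"
    using z s less by (intro mult_left_mono mono) auto
  with z show ?thesis by (simp add: algebra_simps)
next
  case greater
  from MVT2[OF this, of f f'] deriv m obtain z where z: "m < z" "z < s" "f s - f m = (s - m) * f' z"
    by force
  have "(s - m) * f' m \<le> (s - m) * f' z"
    using z m greater by (intro mult_left_mono mono) auto
  with z show ?thesis by (simp add: algebra_simps)
qed simp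

lemma Theta_tangent:
  assumes "1 \<le> m"
  shows "\<exists>D. \<forall>s\<ge>1. Theta m + D * (s - m) \<le> Theta s"
proof -
  define D where "D = (\<lambda>s. sqrt (1 + ln s) + 1 / (2 * sqrt (1 + ln s)))"
  have deriv: "(Theta has_real_derivative D s) (at s)" if "1 \<le> s" for s
  proof -
    have "0 < 1 + ln s" using that by (simp add: add_pos_nonneg)
    then have "((\<lambda>s. s * sqrt (1 + ln s)) has_real_derivative D s) (at s)"
      using that by (auto intro!: derivative_eq_intros simp: D_def field_simps)
    then show ?thesis unfolding Theta_def[abs_def] .
  qed
  have mono: "D s \<le> D t" if "1 \<le> s" "s \<le> t" for s t
  proof -
    \<comment> \<open>In terms of a = sqrt (1 + ln s) the derivative is a + 1/(2a), which increases
      on [1, infinity) because 2 a b >= 1 there.\<close>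
    define a b where "a = sqrt (1 + ln s)" and "b = sqrt (1 + ln t)"
    have ab: "1 \<le> a" "a \<le> b"
      using that by (simp_all add: a_def b_def)
    have "1 * 1 \<le> a * b" using ab by (intro mult_mono) auto
    then have "0 \<le> (b - a) * (2 * (a * b) - 1) / (2 * a * b)"
      using ab by (intro divide_nonneg_nonneg mult_nonneg_nonneg) auto
    also have "\<dots> = (b + 1 / (2 * b)) - (a + 1 / (2 * a))"
      using ab by (simp add: field_simps)
    finally show ?thesis
      by (simp add: D_def a_def b_def)
  qed
  show ?thesis
    using tangent_below[of 1 Theta D m, OF deriv mono assms] by blast
qed

lemma Omega_tangent:
  assumes "0 \<le> m"
  shows "\<exists>D. \<forall>s\<ge>0. Omega m + D * (s - m) \<le> Omega s"
proof (intro exI allI impI)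
  have deriv: "(Omega has_real_derivative 2 + ln (1 + s)) (at s)" if "0 \<le> s" for s
    unfolding Omega_def[abs_def] using that
    by (auto intro!: derivative_eq_intros simp: field_simps)
  show "Omega m + (2 + ln (1 + m)) * (s - m) \<le> Omega s" if "0 \<le> s" for s
    by (rule tangent_below[of 0 Omega "\<lambda>s. 2 + ln (1 + s)"]) (use deriv assms that in auto)
qed

lemma continuous_on_Theta [continuous_intros]:
  assumes "continuous_on S f" "\<And>z. z \<in> S \<Longrightarrow> 1 \<le> f z"
  shows "continuous_on S (\<lambda>z. Theta (f z))"
proof -
  have "f z \<noteq> 0" if "z \<in> S" for z
    using assms(2)[OF that] by simp
  then show ?thesis
    unfolding Theta_def by (intro continuous_intros assms) auto
qed

lemma continuous_on_Omega [continuous_intros]: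
  assumes "continuous_on S f" "\<And>z. z \<in> S \<Longrightarrow> 0 \<le> f z"
  shows "continuous_on S (\<lambda>z. Omega (f z))"
proof -
  have "1 + f z \<noteq> 0" if "z \<in> S" for z
    using assms(2)[OF that] by simp
  then show ?thesis
    unfolding Omega_def by (intro continuous_intros assms) auto
qed

text \<open>Jensen's inequality: average the supporting line of \<open>Theta\<close> at the
  mean.\<close>

lemma Theta_circ_avg_le:
  assumes h: "continuous_on UNIV h" "\<And>x. 1 \<le> h x"
  shows "Theta (circ_avg h) \<le> circ_avg (\<lambda>x. Theta (h x))"
proof -
  have m: "1 \<le> circ_avg h"
    using circ_avg_mono[of "\<lambda>x. 1" h] h by simp
  then obtain D where D: "\<And>s. 1 \<le> s \<Longrightarrow> Theta (circ_avg h) + D * (s - circ_avg h) \<le> Theta s"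
    using Theta_tangent by blast
  note [continuous_intros] = h(1)
  have "Theta (circ_avg h) = circ_avg (\<lambda>x. (Theta (circ_avg h) - D * circ_avg h) + D * h x)"
    by (subst circ_avg_add) (auto intro!: continuous_intros simp: circ_avg_mult_left)
  also have "\<dots> \<le> circ_avg (\<lambda>x. Theta (h x))"
    using D[OF h(2)] by (intro circ_avg_mono continuous_intros h) (simp add: algebra_simps)
  finally show ?thesis .
qed

text \<open>With t = 1 + a^2 and L = 1 + ln t, phi (a^2) is sqrt t sqrt L. Its logarithm is at most
  ln t because L <= t, so \<open>Theta\<close> contributes a second sqrt L, and the two make a full
  logarithm.\<close>

lemma Theta_phi_le:
  assumes "0 \<le> a"
  shows "Theta (phi (a\<^sup>2)) \<le> 2 * Omega a"
proof -
  define t where "t = 1 + a\<^sup>2"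
  define L where "L = 1 + ln t"
  have t: "1 \<le> t" by (simp add: t_def)
  then have L: "1 \<le> L" by (simp add: L_def)
  have Lt: "L \<le> t"
    using ln_le_minus_one[of t] t by (simp add: L_def)
  have phi: "phi (a\<^sup>2) = sqrt t * sqrt L"
    by (simp add: phi_def t_def L_def real_sqrt_mult)
  have "1 + ln (phi (a\<^sup>2)) = 1 + ln t / 2 + ln L / 2"
    unfolding phi using t L by (simp add: ln_mult ln_sqrt)
  also have "\<dots> \<le> L"
  proof -
    have "ln L \<le> ln t" using L Lt by simp
    moreover have "L = 1 + ln t" by (simp add: L_def)
    ultimately show ?thesis by linarith
  qed
  finally have "Theta (phi (a\<^sup>2)) \<le> (sqrt t * sqrt L) * sqrt L"
    unfolding Theta_def phi using t L by (intro mult_left_mono) auto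
  also have "\<dots> = sqrt t * L"
    using L by simp
  also have "\<dots> \<le> (1 + a) * (2 * (1 + ln (1 + a)))"
  proof (intro mult_mono)
    have tle: "t \<le> (1 + a)\<^sup>2"
      using assms by (simp add: t_def power2_eq_square algebra_simps)
    then show "sqrt t \<le> 1 + a"
      using assms real_le_lsqrt by simp
    have "ln t \<le> ln ((1 + a)\<^sup>2)"
      using tle t by (subst ln_le_cancel_iff) (auto intro: less_le_trans)
    then show "L \<le> 2 * (1 + ln (1 + a))"
      using assms by (simp add: L_def ln_realpow)
  qed (use assms L in auto)
  finally show ?thesis by (simp add: Omega_def mult.left_commute)
qed

text \<open>A constant leaves \<open>phi\<close> at linear cost because ln (2 C) <= 2 C - 1. This
  serves to put the quadratic bound from the first variable into the \<open>phi\<close> of the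
  second.\<close>

lemma phi_const_mult_le:
  assumes "1 \<le> C" "1 \<le> b"
  shows "phi (C * b\<^sup>2) \<le> 2 * C * Theta b"
proof -
  have b2: "1 \<le> b\<^sup>2" using assms by simp
  have Cb: "1 * 1 \<le> C * b\<^sup>2"
    using assms b2 by (intro mult_mono) auto
  have "phi (C * b\<^sup>2) \<le> sqrt ((2 * C * b\<^sup>2) * (2 * C * (1 + ln b)))"
    unfolding phi_def
  proof (intro real_sqrt_le_mono mult_mono)
    show "1 + C * b\<^sup>2 \<le> 2 * C * b\<^sup>2"
      using Cb by simp
    then have "ln (1 + C * b\<^sup>2) \<le> ln (2 * C * b\<^sup>2)"
      using Cb by simp
    also have "\<dots> = ln (2 * C) + 2 * ln b"
      using assms by (simp add: ln_mult ln_realpow)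
    also have "ln (2 * C) \<le> 2 * C - 1"
      using assms by (intro ln_le_minus_one) auto
    also have "2 * C - 1 + 2 * ln b \<le> 2 * C - 1 + 2 * C * ln b"
      using assms mult_right_mono[of 1 C "ln b"] by simp
    finally show "1 + ln (1 + C * b\<^sup>2) \<le> 2 * C * (1 + ln b)"
      by (simp add: algebra_simps)
  qed (use assms Cb in auto)
  also have "\<dots> = sqrt ((2 * C)\<^sup>2 * (b\<^sup>2 * (1 + ln b)))"
    by (simp add: power2_eq_square mult_ac)
  also have "\<dots> = 2 * C * Theta b"
    using assms by (simp add: Theta_def real_sqrt_mult)
  finally show ?thesis .
qed

lemma continuous_on_circ_avg [continuous_intros]:
  fixes f :: "'a::topological_space \<Rightarrow> real \<Rightarrow> real"
  assumes "continuous_on UNIV (\<lambda>z. f (fst z) (snd z))"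
  shows "continuous_on UNIV (\<lambda>y. circ_avg (f y))"
proof -
  have "continuous_on (UNIV \<times> cbox 0 (2 * pi)) (\<lambda>(u, x). f u x)"
    unfolding case_prod_unfold by (rule continuous_on_subset[OF assms]) simp
  from integral_continuous_on_param[OF this] show ?thesis
    unfolding circ_avg_def by (intro continuous_intros) simp
qed

definition coeff_const :: real where "coeff_const = 225 * exp 4"

lemma coeff_const_ge: "1 \<le> coeff_const"
proof -
  have "1 * 1 \<le> 225 * exp (4 :: real)" by (intro mult_mono) auto
  then show ?thesis by (simp add: coeff_const_def)
qed

lemma double_lacunary_difference_coefficients_le:
  fixes a :: "nat \<Rightarrow> nat \<Rightarrow> complex"
  assumes N: "3 ^ K \<le> N"
  defines "F \<equiv> (\<lambda>x y. \<Sum>m\<le>N. \<Sum>n\<le>N. a m n * (cis (real m * x) * cis (real n * y)))"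
  shows "(\<Sum>k\<le>K. \<Sum>l<k. \<Sum>k'\<le>K. \<Sum>l'<k'. (norm (a (3 ^ k - 3 ^ l) (3 ^ k' - 3 ^ l')))\<^sup>2)
    \<le> coeff_const * (4 * coeff_const * circ_avg (\<lambda>y. circ_avg (\<lambda>x. Omega (norm (F x y)))))\<^sup>2"
proof -
  let ?C = coeff_const
  define I where "I = Sigma {..K} (\<lambda>k. {..<k})"
  \<comment> \<open>The first frequency becomes a component index \<open>(k, l)\<close>, so the
    estimate in y sees one vector valued polynomial.\<close>
  define c where "c = (\<lambda>(k, l) n. a (3 ^ k - 3 ^ l) n)"
  have I: "finite I" unfolding I_def by auto
  have sum_I: "(\<Sum>k\<le>K. \<Sum>l<k. h k l) = (\<Sum>i\<in>I. h (fst i) (snd i))" for h :: "nat \<Rightarrow> nat \<Rightarrow> real"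
    unfolding I_def by (simp add: sum.Sigma case_prod_unfold)
  have F: "continuous_on S (\<lambda>z. F (f z) (g z))"
    if "continuous_on S f" "continuous_on S g" for S :: "'z::topological_space set" and f g
    unfolding F_def using that by (intro continuous_intros)
  note [continuous_intros] = F
  define A where "A = (\<lambda>y. \<Sum>i\<in>I. (norm (\<Sum>n\<le>N. c i n * cis (real n * y)))\<^sup>2)"
  define B where "B = (\<lambda>y. circ_avg (\<lambda>x. phi ((norm (F x y))\<^sup>2)))"
  have B: "1 \<le> B y" for y
  proof -
    have "circ_avg (\<lambda>x. 1) \<le> B y"
      unfolding B_def
    proof (rule circ_avg_mono)
      show "continuous_on UNIV (\<lambda>x. phi ((norm (F x y))\<^sup>2))"
        by (intro continuous_intros) auto
    qed (auto intro: phi_ge_1)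
    then show ?thesis by simp
  qed
  have AB: "A y \<le> ?C * (B y)\<^sup>2" for y
  proof -
    \<comment> \<open>A single component: for fixed \<open>y\<close> the estimate in x is the scalar
      case.\<close>
    define d where "d = (\<lambda>(_::unit) m. \<Sum>n\<le>N. a m n * cis (real n * y))"
    have "(\<Sum>m\<le>N. d i m * cis (real m * x)) = F x y" for x i
      unfolding F_def d_def sum_distrib_right by (simp only: mult_ac)
    then have "(\<Sum>k\<le>K. \<Sum>l<k. (norm (d () (3 ^ k - 3 ^ l)))\<^sup>2) \<le> ?C * (B y)\<^sup>2"
      using lacunary_difference_coefficients_le[of "{()}" K N d] N by (simp add: B_def coeff_const_def)
    moreover have "A y = (\<Sum>k\<le>K. \<Sum>l<k. (norm (d () (3 ^ k - 3 ^ l)))\<^sup>2)"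
      unfolding A_def c_def d_def sum_I by (simp only: case_prod_unfold)
    ultimately show ?thesis by simp
  qed
  \<comment> \<open>The constant is 2 C from \<open>phi_const_mult_le\<close> times 2 from
    \<open>Theta_phi_le\<close>.\<close>
  have "phi (A y) \<le> 4 * ?C * circ_avg (\<lambda>x. Omega (norm (F x y)))" for y
  proof -
    have "phi (A y) \<le> phi (?C * (B y)\<^sup>2)"
      by (intro phi_mono AB) (simp add: A_def sum_nonneg)
    also have "\<dots> \<le> 2 * ?C * Theta (B y)"
      by (rule phi_const_mult_le[OF coeff_const_ge B])
    also have "Theta (B y) \<le> circ_avg (\<lambda>x. Theta (phi ((norm (F x y))\<^sup>2)))"
      unfolding B_def by (intro Theta_circ_avg_le continuous_intros phi_ge_1) auto
    also have "\<dots> \<le> circ_avg (\<lambda>x. 2 * Omega (norm (F x y)))"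
      by (intro circ_avg_mono continuous_intros phi_ge_1 Theta_phi_le) auto
    also have "\<dots> = 2 * circ_avg (\<lambda>x. Omega (norm (F x y)))"
      by (rule circ_avg_mult_left)
    finally show ?thesis
      using coeff_const_ge by (simp add: mult_ac)
  qed
  then have "circ_avg (\<lambda>y. phi (A y)) \<le> circ_avg (\<lambda>y. 4 * ?C * circ_avg (\<lambda>x. Omega (norm (F x y))))"
    unfolding A_def by (intro circ_avg_mono continuous_intros) (auto intro: sum_nonneg)
  also have "\<dots> = 4 * ?C * circ_avg (\<lambda>y. circ_avg (\<lambda>x. Omega (norm (F x y))))"
    by (rule circ_avg_mult_left)
  finally have phiA: "circ_avg (\<lambda>y. phi (A y)) \<le> \<dots>" .
  have "circ_avg (\<lambda>y. 0) \<le> circ_avg (\<lambda>y. phi (A y))"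
    unfolding A_def by (intro circ_avg_mono continuous_intros order_trans[OF zero_le_one phi_ge_1]) (auto intro: sum_nonneg)
  then have nonneg: "0 \<le> circ_avg (\<lambda>y. phi (A y))" by simp
  have "(\<Sum>k\<le>K. \<Sum>l<k. \<Sum>k'\<le>K. \<Sum>l'<k'. (norm (a (3 ^ k - 3 ^ l) (3 ^ k' - 3 ^ l')))\<^sup>2)
      = (\<Sum>i\<in>I. \<Sum>k'\<le>K. \<Sum>l'<k'. (norm (c i (3 ^ k' - 3 ^ l')))\<^sup>2)"
    unfolding c_def case_prod_unfold by (rule sum_I)
  also have "\<dots> \<le> ?C * (circ_avg (\<lambda>y. phi (A y)))\<^sup>2"
    using lacunary_difference_coefficients_le[OF I N, of c] by (simp add: A_def coeff_const_def)
  also have "\<dots> \<le> ?C * (4 * ?C * circ_avg (\<lambda>y. circ_avg (\<lambda>x. Omega (norm (F x y)))))\<^sup>2"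
    using phiA nonneg coeff_const_ge by (intro mult_left_mono power_mono) auto
  finally show ?thesis .
qed

section \<open>Fejer means\<close>

interpretation torus2: prob_space torus2
  by (rule prob_space_torus2)

lemma measurable_circle_measure_id: "(\<lambda>x. x) \<in> borel_measurable circle_measure"
proof -
  have "(\<lambda>x. x) \<in> borel_measurable (restrict_space lborel {0..<2 * pi})"
    by (rule measurable_restrict_space1) simp
  then show ?thesis
    unfolding circle_measure_def measurable_cong_sets[OF sets_scale_measure refl] .
qed

lemma fst_borel_measurable_torus2: "fst \<in> borel_measurable torus2"
  unfolding torus2_def
proof (rule measurable_completion)
  have "fst \<in> circle_measure \<Otimes>\<^sub>M circle_measure \<rightarrow>\<^sub>M circle_measure"
    by (rule measurable_fst)
  from measurable_compose[where f=fst and g="\<lambda>x. x", OF this measurable_circle_measure_id]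
  show "fst \<in> borel_measurable (circle_measure \<Otimes>\<^sub>M circle_measure)" .
qed

lemma snd_borel_measurable_torus2: "snd \<in> borel_measurable torus2"
  unfolding torus2_def
proof (rule measurable_completion)
  have "snd \<in> circle_measure \<Otimes>\<^sub>M circle_measure \<rightarrow>\<^sub>M circle_measure"
    by (rule measurable_snd)
  from measurable_compose[where f=snd and g="\<lambda>x. x", OF this measurable_circle_measure_id]
  show "snd \<in> borel_measurable (circle_measure \<Otimes>\<^sub>M circle_measure)" .
qed

lemma nn_integral_circle_measure:
  assumes h: "continuous_on UNIV h" "\<And>x. 0 \<le> h x"
  shows "(\<integral>\<^sup>+x. ennreal (h x) \<partial>circle_measure) = ennreal (circ_avg h)"
proof -
  have meas [measurable]: "h \<in> borel_measurable borel"
    using h(1) by (rule borel_measurable_continuous_onI)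
  have "(\<integral>\<^sup>+x. ennreal (h x) \<partial>restrict_space lborel {0..<2 * pi}) = (\<integral>\<^sup>+x. ennreal (h x) * indicator {0..<2 * pi} x \<partial>lborel)"
    by (rule nn_integral_restrict_space) simp
  also have "\<dots> = (\<integral>\<^sup>+x. ennreal (h x) * indicator {0..2 * pi} x \<partial>lborel)"
    \<comment> \<open>The half-open and the closed interval differ by the null set {2 pi}.\<close>
    by (intro nn_integral_cong_AE eventually_mono[OF AE_lborel_singleton[of "2 * pi"]]) (auto simp: indicator_def)
  also have "\<dots> = ennreal (integral {0..2 * pi} h)"
    using integrable_integral[OF integrable_on_period[OF h(1)]] h(2)
    by (intro nn_integral_has_integral_lebesgue') auto
  finally have "(\<integral>\<^sup>+x. ennreal (h x) \<partial>circle_measure) = ennreal (1 / (2 * pi)) * ennreal (integral {0..2 * pi} h)"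
    unfolding circle_measure_def
    by (subst nn_integral_scale_measure) (auto intro!: measurable_restrict_space1)
  also have "\<dots> = ennreal (1 / (2 * pi) * integral {0..2 * pi} h)"
    using integral_nonneg[OF integrable_on_period[OF h(1)]] h(2)
    by (intro ennreal_mult[symmetric]) simp_all
  also have "1 / (2 * pi) * integral {0..2 * pi} h = circ_avg h"
    unfolding circ_avg_def real_scaleR_def by (simp only: inverse_eq_divide)
  finally show ?thesis .
qed

section \<open>The Fejer kernel and its Fourier expansion\<close>

definition fejer :: "nat \<Rightarrow> real \<Rightarrow> real" where
  "fejer N x = (norm (\<Sum>j<N. cis (real j * x)))\<^sup>2 / N"

definition fejer_weight :: "nat \<Rightarrow> int \<Rightarrow> real" where
  "fejer_weight N m = 1 - \<bar>of_int m\<bar> / N"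

text \<open>For |m| <= N there are exactly N - |m| pairs of indices below \<open>N\<close> with
  difference \<open>m\<close>.\<close>

lemma sum_differences:
  fixes g :: "int \<Rightarrow> complex"
  shows "(\<Sum>j<N. \<Sum>k<N. g (int j - int k)) = (\<Sum>m\<in>{- int N..int N}. of_int (int N - \<bar>m\<bar>) * g m)"
proof (induction N)
  case 0
  then show ?case by simp
next
  case (Suc N)
  have "(\<Sum>j<Suc N. \<Sum>k<Suc N. g (int j - int k))
      = (\<Sum>j<N. \<Sum>k<N. g (int j - int k)) + (\<Sum>j<N. g (int j - int N)) + (\<Sum>k\<le>N. g (int N - int k))"
    by (simp add: sum.distrib lessThan_Suc_atMost[symmetric])
  also have "(\<Sum>j<N. g (int j - int N)) = (\<Sum>m\<in>{- int N..<0}. g m)"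
    by (rule sum.reindex_bij_witness[of _ "\<lambda>m. nat (m + int N)" "\<lambda>j. int j - int N"]) auto
  also have "(\<Sum>k\<le>N. g (int N - int k)) = (\<Sum>m\<in>{0..int N}. g m)"
    by (rule sum.reindex_bij_witness[of _ "\<lambda>m. nat (int N - m)" "\<lambda>k. int N - int k"]) auto
  also have "(\<Sum>j<N. \<Sum>k<N. g (int j - int k)) + (\<Sum>m\<in>{- int N..<0}. g m) + (\<Sum>m\<in>{0..int N}. g m)
     = (\<Sum>m\<in>{- int N..int N}. of_int (int N - \<bar>m\<bar>) * g m) + (\<Sum>m\<in>{- int N..int N}. g m)"
  proof -
    have "{- int N..int N} = {- int N..<0} \<union> {0..int N}" by auto
    then have "(\<Sum>m\<in>{- int N..int N}. g m) = (\<Sum>m\<in>{- int N..<0}. g m) + (\<Sum>m\<in>{0..int N}. g m)"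
      by (simp only:) (rule sum.union_disjoint; auto)
    then show ?thesis
      unfolding Suc.IH by (simp add: add.assoc)
  qed
  also have "\<dots> = (\<Sum>m\<in>{- int N..int N}. of_int (int (Suc N) - \<bar>m\<bar>) * g m)"
    unfolding sum.distrib[symmetric] by (intro sum.cong) (auto simp: algebra_simps)
  \<comment> \<open>The two frequencies added at the ends have weight 0.\<close>
  also have "\<dots> = (\<Sum>m\<in>{- int (Suc N)..int (Suc N)}. of_int (int (Suc N) - \<bar>m\<bar>) * g m)"
  proof (rule sum.mono_neutral_left)
    show "\<forall>m\<in>{- int (Suc N)..int (Suc N)} - {- int N..int N}. of_int (int (Suc N) - \<bar>m\<bar>) * g m = 0"
    proof
      fix m assume "m \<in> {- int (Suc N)..int (Suc N)} - {- int N..int N}"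
      then have "int (Suc N) - \<bar>m\<bar> = 0" by auto
      then show "of_int (int (Suc N) - \<bar>m\<bar>) * g m = 0" by (simp only: of_int_0 mult_zero_left)
    qed
  qed auto
  finally show ?case .
qed

lemma fejer_nonneg: "0 \<le> fejer N x"
  by (simp add: fejer_def)

lemma continuous_on_fejer [continuous_intros]:
  "continuous_on S f \<Longrightarrow> continuous_on S (\<lambda>z. fejer N (f z))"
  unfolding fejer_def divide_inverse by (intro continuous_intros)

lemma fejer_measurable [measurable]: "fejer N \<in> borel_measurable borel"
  by (rule borel_measurable_continuous_onI) (rule continuous_on_fejer[OF continuous_on_id])

lemma fejer_expansion:
  assumes "0 < N"
  shows "complex_of_real (fejer N x) = (\<Sum>m\<in>{- int N..int N}. of_real (fejer_weight N m) * cis (of_int m * x))"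
proof -
  have "complex_of_real ((norm (\<Sum>j<N. cis (real j * x)))\<^sup>2) = (\<Sum>j<N. \<Sum>k<N. cis (of_int (int j - int k) * x))"
    unfolding complex_norm_square cnj_sum sum_product
    by (intro sum.cong) (simp_all add: cis_cnj cis_mult algebra_simps)
  also have "\<dots> = (\<Sum>m\<in>{- int N..int N}. of_int (int N - \<bar>m\<bar>) * cis (of_int m * x))"
    by (rule sum_differences)
  finally have "complex_of_real (fejer N x) = (\<Sum>m\<in>{- int N..int N}. of_int (int N - \<bar>m\<bar>) * cis (of_int m * x)) / of_nat N"
    by (simp add: fejer_def)
  also have "\<dots> = (\<Sum>m\<in>{- int N..int N}. of_real (fejer_weight N m) * cis (of_int m * x))"
    unfolding sum_divide_distrib using assms
    by (intro sum.cong) (simp_all add: fejer_weight_def field_simps flip: of_int_abs)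
  finally show ?thesis .
qed

lemma circ_avg_fejer:
  assumes "0 < N"
  shows "circ_avg (\<lambda>x. fejer N (a - x)) = 1"
proof -
  have "complex_of_real (fejer N (a - x)) =
      (\<Sum>m\<in>{- int N..int N}. (of_real (fejer_weight N m) * cis (of_int m * a)) * cis (of_int (- m) * x))" for x
    unfolding fejer_expansion[OF assms] by (intro sum.cong) (simp_all add: cis_mult algebra_simps)
  then have "complex_of_real (circ_avg (\<lambda>x. fejer N (a - x))) =
      (\<Sum>m\<in>{- int N..int N}. (of_real (fejer_weight N m) * cis (of_int m * a)) * (if - m = 0 then 1 else 0))"
    by (subst circ_avg_of_real[symmetric])
       (simp_all only: circ_avg_sum[OF finite_atLeastAtMost_int] circ_avg_mult_left circ_avg_cis continuous_intros)
  also have "\<dots> = (\<Sum>m\<in>{0}. of_real (fejer_weight N m) * cis (of_int m * a))"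
    by (rule sum.mono_neutral_cong_right) auto
  also have "\<dots> = 1"
    by (simp add: fejer_weight_def)
  finally show ?thesis
    by (simp only: of_real_eq_1_iff)
qed

definition fejer2 :: "nat \<Rightarrow> real \<Rightarrow> real \<Rightarrow> real \<times> real \<Rightarrow> real" where
  "fejer2 N a b z = fejer N (a - fst z) * fejer N (b - snd z)"

lemma fejer2_nonneg: "0 \<le> fejer2 N a b z"
  by (simp add: fejer2_def fejer_nonneg)

lemma fejer2_measurable: "fejer2 N a b \<in> borel_measurable torus2"
  unfolding fejer2_def[abs_def]
  by (intro borel_measurable_times measurable_compose[OF _ fejer_measurable] borel_measurable_diff
      borel_measurable_const fst_borel_measurable_torus2 snd_borel_measurable_torus2)

lemma fejer_le: "fejer N x \<le> N"
proof -
  have "norm (\<Sum>j<N. cis (real j * x)) \<le> N"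
    using norm_sum[of "\<lambda>j. cis (real j * x)" "{..<N}"] by simp
  then have "(norm (\<Sum>j<N. cis (real j * x)))\<^sup>2 / N \<le> (real N)\<^sup>2 / N"
    by (intro divide_right_mono power_mono) auto
  then show ?thesis
    by (cases "N = 0") (simp_all add: fejer_def power2_eq_square)
qed

lemma fejer2_le: "fejer2 N a b z \<le> real N * real N"
  unfolding fejer2_def by (intro mult_mono fejer_le fejer_nonneg) auto

lemma integrable_bounded_mult:
  fixes g :: "'a \<Rightarrow> complex"
  assumes "integrable M g" "k \<in> borel_measurable M" "\<And>z. norm (k z) \<le> B"
  shows "integrable M (\<lambda>z. g z * k z)"
proof (rule Bochner_Integration.integrable_bound)
  show "integrable M (\<lambda>z. B * norm (g z))"
    using assms(1) by auto
  show "AE z in M. norm (g z * k z) \<le> norm (B * norm (g z))"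
    using assms(3) by (auto simp: norm_mult abs_mult mult.commute[of B] intro!: mult_left_mono order_trans[OF _ abs_ge_self])
  show "(\<lambda>z. g z * k z) \<in> borel_measurable M"
    using borel_measurable_integrable[OF assms(1)] assms(2) by (rule borel_measurable_times)
qed

lemma integral_fejer2:
  assumes "0 < N"
  shows "integral\<^sup>L torus2 (fejer2 N a b) = 1"
proof -
  interpret C: prob_space circle_measure by (rule prob_space_circle_measure)
  note [measurable] = measurable_circle_measure_id
  have [measurable]: "(\<lambda>x. fejer N (a - x)) \<in> borel_measurable circle_measure" for a
    by measurable
  have one: "(\<integral>\<^sup>+x. ennreal (fejer N (a - x)) \<partial>circle_measure) = 1" for a
    by (subst nn_integral_circle_measure) (simp_all add: circ_avg_fejer assms fejer_nonneg continuous_intros)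
  have [measurable]: "fejer2 N a b \<in> borel_measurable (circle_measure \<Otimes>\<^sub>M circle_measure)"
    unfolding fejer2_def[abs_def] by measurable
  have "(\<integral>\<^sup>+z. ennreal (fejer2 N a b z) \<partial>torus2) = (\<integral>\<^sup>+z. ennreal (fejer2 N a b z) \<partial>(circle_measure \<Otimes>\<^sub>M circle_measure))"
    unfolding torus2_def by (rule nn_integral_completion)
  also have "\<dots> = (\<integral>\<^sup>+x. \<integral>\<^sup>+y. ennreal (fejer2 N a b (x, y)) \<partial>circle_measure \<partial>circle_measure)"
    by (rule C.nn_integral_fst[symmetric]) measurable
  also have "\<dots> = 1"
    by (simp add: fejer2_def ennreal_mult fejer_nonneg nn_integral_cmult one)
  finally show ?thesis
    using integral_eq_nn_integral[of "fejer2 N a b" torus2] by (simp add: fejer2_nonneg fejer2_measurable)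
qed

lemma integral_fejer2_expansion:
  fixes g :: "real \<times> real \<Rightarrow> complex"
  assumes g: "integrable torus2 g" and N: "0 < N"
  shows "(LINT z|torus2. g z * of_real (fejer2 N a b z)) =
    (\<Sum>m\<in>{- int N..int N}. \<Sum>n\<in>{- int N..int N}. of_real (fejer_weight N m * fejer_weight N n) * fourier_coeff g m n
       * (cis (of_int m * a) * cis (of_int n * b)))"
proof -
  let ?e = "\<lambda>m n z. cis (- (of_int m * fst z + of_int n * snd z))"
  have exp_cis: "exp (- \<i> * complex_of_real t) = cis (- t)" for t
    by (simp add: cis_conv_exp)
  have coeff: "fourier_coeff g m n = (LINT z|torus2. g z * ?e m n z)" for m n
    by (simp only: fourier_coeff_def exp_cis case_prod_unfold prod.collapse)
  have e: "cis (of_int m * (a - fst z)) * cis (of_int n * (b - snd z)) = cis (of_int m * a) * cis (of_int n * b) * ?e m n z" for m n z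
    unfolding cis_mult by (rule arg_cong[of _ _ cis]) (simp only: algebra_simps)
  have int: "integrable torus2 (\<lambda>z. g z * ?e m n z)" for m n
  proof (rule integrable_bounded_mult[OF g])
    show "?e m n \<in> borel_measurable torus2"
      by (intro measurable_compose[OF _ borel_measurable_continuous_onI[OF continuous_on_cis[OF continuous_on_id]]]
          borel_measurable_uminus borel_measurable_add borel_measurable_times borel_measurable_const
          fst_borel_measurable_torus2 snd_borel_measurable_torus2)
    show "norm (?e m n z) \<le> 1" for z
      by (simp only: norm_cis order_refl)
  qed
  have "g z * of_real (fejer2 N a b z) = (\<Sum>m\<in>{- int N..int N}. \<Sum>n\<in>{- int N..int N}.
     (of_real (fejer_weight N m * fejer_weight N n) * (cis (of_int m * a) * cis (of_int n * b))) * (g z * ?e m n z))" for z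
  proof -
    have "g z * of_real (fejer2 N a b z) = (\<Sum>m\<in>{- int N..int N}. \<Sum>n\<in>{- int N..int N}.
      g z * ((of_real (fejer_weight N m) * cis (of_int m * (a - fst z))) * (of_real (fejer_weight N n) * cis (of_int n * (b - snd z)))))"
      unfolding fejer2_def of_real_mult fejer_expansion[OF N] sum_product by (simp only: sum_distrib_left)
    also have "\<dots> = (\<Sum>m\<in>{- int N..int N}. \<Sum>n\<in>{- int N..int N}. (of_real (fejer_weight N m * fejer_weight N n) * (cis (of_int m * a) * cis (of_int n * b))) * (g z * ?e m n z))"
    proof (intro sum.cong refl)
      fix m n
      have "g z * ((of_real (fejer_weight N m) * cis (of_int m * (a - fst z))) * (of_real (fejer_weight N n) * cis (of_int n * (b - snd z))))
        = (of_real (fejer_weight N m * fejer_weight N n) * g z) * (cis (of_int m * (a - fst z)) * cis (of_int n * (b - snd z)))"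
        by (simp only: of_real_mult mult_ac)
      then show "g z * ((of_real (fejer_weight N m) * cis (of_int m * (a - fst z))) * (of_real (fejer_weight N n) * cis (of_int n * (b - snd z))))
        = (of_real (fejer_weight N m * fejer_weight N n) * (cis (of_int m * a) * cis (of_int n * b))) * (g z * ?e m n z)"
        unfolding e by (simp only: mult_ac)
    qed
    finally show ?thesis .
  qed
  then have "(LINT z|torus2. g z * of_real (fejer2 N a b z)) = (LINT z|torus2. (\<Sum>m\<in>{- int N..int N}. \<Sum>n\<in>{- int N..int N}.
     (of_real (fejer_weight N m * fejer_weight N n) * (cis (of_int m * a) * cis (of_int n * b))) * (g z * ?e m n z)))"
    by (simp only:)
  also have "\<dots> = (\<Sum>m\<in>{- int N..int N}. (LINT z|torus2. (\<Sum>n\<in>{- int N..int N}.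
     (of_real (fejer_weight N m * fejer_weight N n) * (cis (of_int m * a) * cis (of_int n * b))) * (g z * ?e m n z))))"
    by (intro Bochner_Integration.integral_sum Bochner_Integration.integrable_sum integrable_mult_right int)
  also have "\<dots> = (\<Sum>m\<in>{- int N..int N}. \<Sum>n\<in>{- int N..int N}.
     (LINT z|torus2. (of_real (fejer_weight N m * fejer_weight N n) * (cis (of_int m * a) * cis (of_int n * b))) * (g z * ?e m n z)))"
    by (intro sum.cong refl Bochner_Integration.integral_sum integrable_mult_right int)
  also have "\<dots> = (\<Sum>m\<in>{- int N..int N}. \<Sum>n\<in>{- int N..int N}. of_real (fejer_weight N m * fejer_weight N n) * fourier_coeff g m n
       * (cis (of_int m * a) * cis (of_int n * b)))"
    unfolding coeff integral_mult_right_zero by (intro sum.cong refl) (simp only: mult.assoc mult.left_commute mult.commute)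
  finally show ?thesis .
qed

lemma Omega_mono: "0 \<le> s \<Longrightarrow> s \<le> t \<Longrightarrow> Omega s \<le> Omega t"
  unfolding Omega_def by (intro mult_mono) auto

lemma Omega_nonneg: "0 \<le> s \<Longrightarrow> 0 \<le> Omega s"
  by (simp add: Omega_def)

text \<open>Jensen's inequality for the probability density \<open>fejer2 N a b\<close>, through the
  supporting line of \<open>Omega\<close> at the weighted mean \<open>s\<close> of |f|. Monotonicity
  of \<open>Omega\<close> then passes from \<open>s\<close> to the norm of the complex mean.\<close>

lemma Omega_fejer_le:
  fixes f :: "real \<times> real \<Rightarrow> complex"
  assumes f: "integrable torus2 f" and Of: "integrable torus2 (\<lambda>z. Omega (norm (f z)))" and N: "0 < N"
  shows "Omega (norm (LINT z|torus2. f z * of_real (fejer2 N a b z))) \<le> (LINT z|torus2. Omega (norm (f z)) * fejer2 N a b z)"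
proof -
  define s where "s = (LINT z|torus2. norm (f z) * fejer2 N a b z)"
  have int: "integrable torus2 (\<lambda>z. h z * fejer2 N a b z)" if "integrable torus2 h" for h :: "_ \<Rightarrow> real"
  proof (rule Bochner_Integration.integrable_bound)
    show "integrable torus2 (\<lambda>z. (real N * real N) * norm (h z))"
      using that by auto
    show "AE z in torus2. norm (h z * fejer2 N a b z) \<le> norm ((real N * real N) * norm (h z))"
      using fejer2_nonneg[of N a b] fejer2_le[of N a b]
      by (intro AE_I2) (auto simp: abs_mult mult.commute intro!: mult_left_mono)
    show "(\<lambda>z. h z * fejer2 N a b z) \<in> borel_measurable torus2"
      using that by (intro borel_measurable_times borel_measurable_integrable fejer2_measurable)
  qed
  have kint: "integrable torus2 (fejer2 N a b)"
    using int[of "\<lambda>_. 1"] by simp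
  have nle: "norm (LINT z|torus2. f z * of_real (fejer2 N a b z)) \<le> s"
    using integral_norm_bound[of torus2 "\<lambda>z. f z * of_real (fejer2 N a b z)"]
    by (simp add: s_def norm_mult fejer2_nonneg)
  then have s0: "0 \<le> s" by (rule order_trans[OF norm_ge_zero])
  then obtain D where D: "\<And>t. 0 \<le> t \<Longrightarrow> Omega s + D * (t - s) \<le> Omega t"
    using Omega_tangent by blast
  have "Omega s = (LINT z|torus2. (Omega s - D * s) * fejer2 N a b z + D * (norm (f z) * fejer2 N a b z))"
    using int[OF integrable_norm[OF f]] kint integral_fejer2[OF N]
    by (simp add: s_def[symmetric])
  also have "\<dots> \<le> (LINT z|torus2. Omega (norm (f z)) * fejer2 N a b z)"
  proof (rule integral_mono)
    show "integrable torus2 (\<lambda>z. (Omega s - D * s) * fejer2 N a b z + D * (norm (f z) * fejer2 N a b z))"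
      using int[OF integrable_norm[OF f]] kint by auto
    show "(Omega s - D * s) * fejer2 N a b z + D * (norm (f z) * fejer2 N a b z) \<le> Omega (norm (f z)) * fejer2 N a b z" for z
      using mult_right_mono[OF D[OF norm_ge_zero[of "f z"]] fejer2_nonneg[of N a b z]] by (simp add: algebra_simps)
  qed (rule int[OF Of])
  finally show ?thesis
    using Omega_mono[OF norm_ge_zero nle] by simp
qed

text \<open>Defined by its coefficients, so that it is visibly a continuous trigonometric
  polynomial; \<open>integral_fejer2_expansion\<close> identifies it with the convolution with the
  Fejer kernel.\<close>

definition fejer_mean :: "nat \<Rightarrow> (real \<times> real \<Rightarrow> complex) \<Rightarrow> real \<Rightarrow> real \<Rightarrow> complex" where
  "fejer_mean N g a b = (\<Sum>m\<in>{- int N..int N}. \<Sum>n\<in>{- int N..int N}.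
     of_real (fejer_weight N m * fejer_weight N n) * fourier_coeff g m n * (cis (of_int m * a) * cis (of_int n * b)))"

lemma continuous_on_fejer_mean [continuous_intros]:
  "continuous_on S f \<Longrightarrow> continuous_on S h \<Longrightarrow> continuous_on S (\<lambda>z. fejer_mean N g (f z) (h z))"
  unfolding fejer_mean_def by (intro continuous_intros)

lemma fourier_coeff_0_0: "fourier_coeff g 0 0 = integral\<^sup>L torus2 g"
  by (simp add: fourier_coeff_def)

lemma circ_avg_fejer_mean: "circ_avg (\<lambda>b. circ_avg (\<lambda>a. fejer_mean N g a b)) = integral\<^sup>L torus2 g"
proof -
  let ?I = "{- int N..int N}"
  let ?w = "\<lambda>m n. complex_of_real (fejer_weight N m * fejer_weight N n) * fourier_coeff g m n"
  have delta: "(\<Sum>m\<in>?I. (if m = 0 then 1 else 0) * h m) = h 0" for h :: "int \<Rightarrow> complex"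
    by (subst sum.mono_neutral_right[of ?I "{0}"]) auto
  have "circ_avg (\<lambda>a. fejer_mean N g a b) = (\<Sum>n\<in>?I. ?w 0 n * cis (of_int n * b))" for b
  proof -
    have "fejer_mean N g a b = (\<Sum>m\<in>?I. (\<Sum>n\<in>?I. ?w m n * cis (of_int n * b)) * cis (of_int m * a))" for a
      unfolding fejer_mean_def sum_distrib_right by (intro sum.cong refl) (simp only: mult_ac)
    then have "circ_avg (\<lambda>a. fejer_mean N g a b) = (\<Sum>m\<in>?I. (\<Sum>n\<in>?I. ?w m n * cis (of_int n * b)) * (if m = 0 then 1 else 0))"
      by (simp only: circ_avg_sum[OF finite_atLeastAtMost_int] continuous_intros circ_avg_mult_left circ_avg_cis)
    then show ?thesis
      by (simp only: mult.commute[of _ "if _ then _ else _"] delta)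
  qed
  then have "circ_avg (\<lambda>b. circ_avg (\<lambda>a. fejer_mean N g a b)) = (\<Sum>n\<in>?I. ?w 0 n * (if n = 0 then 1 else 0))"
    by (simp only: circ_avg_sum[OF finite_atLeastAtMost_int] continuous_intros circ_avg_mult_left circ_avg_cis)
  also have "\<dots> = ?w 0 0"
    by (simp only: mult.commute[of _ "if _ then _ else _"] delta)
  also have "\<dots> = integral\<^sup>L torus2 g"
    by (simp add: fejer_weight_def fourier_coeff_0_0)
  finally show ?thesis .
qed

text \<open>The bound in \<open>Omega_fejer_le\<close> is itself a Fejer mean, that of Omega(|f|).
  By \<open>circ_avg_fejer_mean\<close> its average over the torus is the integral of Omega(|f|),
  read off from the coefficient at (0, 0).\<close>

lemma circ_avg_Omega_fejer_mean_le:
  fixes f :: "real \<times> real \<Rightarrow> complex"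
  assumes f: "integrable torus2 f" and Of: "integrable torus2 (\<lambda>z. Omega (norm (f z)))" and N: "0 < N"
  shows "circ_avg (\<lambda>b. circ_avg (\<lambda>a. Omega (norm (fejer_mean N f a b)))) \<le> (LINT z|torus2. Omega (norm (f z)))"
proof -
  define g where "g = (\<lambda>z. complex_of_real (Omega (norm (f z))))"
  have g: "integrable torus2 g"
    unfolding g_def using Of by (rule integrable_of_real)
  have le: "Omega (norm (fejer_mean N f a b)) \<le> Re (fejer_mean N g a b)" for a b
  proof -
    have "fejer_mean N g a b = (LINT z|torus2. complex_of_real (Omega (norm (f z)) * fejer2 N a b z))"
      unfolding fejer_mean_def integral_fejer2_expansion[OF g N, symmetric] by (simp add: g_def)
    then have "Re (fejer_mean N g a b) = (LINT z|torus2. Omega (norm (f z)) * fejer2 N a b z)"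
      by (simp only: integral_complex_of_real Re_complex_of_real)
    then show ?thesis
      using Omega_fejer_le[OF f Of N, of a b] unfolding fejer_mean_def integral_fejer2_expansion[OF f N, symmetric]
      by simp
  qed
  have cm: "continuous_on UNIV (\<lambda>a. fejer_mean N h a b)" for h b
    by (intro continuous_intros)
  have cO: "continuous_on UNIV (\<lambda>z. Omega (norm (fejer_mean N f (snd z) (fst z))))"
    by (intro continuous_intros) auto
  have cR: "continuous_on UNIV (\<lambda>z. Re (fejer_mean N g (snd z) (fst z)))"
    by (intro continuous_intros)
  have "circ_avg (\<lambda>b. circ_avg (\<lambda>a. Omega (norm (fejer_mean N f a b)))) \<le> circ_avg (\<lambda>b. circ_avg (\<lambda>a. Re (fejer_mean N g a b)))"
  proof (rule circ_avg_mono)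
    show "circ_avg (\<lambda>a. Omega (norm (fejer_mean N f a b))) \<le> circ_avg (\<lambda>a. Re (fejer_mean N g a b))" for b
      using le by (intro circ_avg_mono continuous_on_Omega continuous_on_norm continuous_on_Re cm) auto
  qed (use continuous_on_circ_avg[OF cO] continuous_on_circ_avg[OF cR] in simp_all)
  also have "\<dots> = Re (circ_avg (\<lambda>b. circ_avg (\<lambda>a. fejer_mean N g a b)))"
  proof -
    have "continuous_on UNIV (\<lambda>b. circ_avg (\<lambda>a. fejer_mean N g a b))"
    proof -
      have "continuous_on (UNIV \<times> cbox 0 (2 * pi)) (\<lambda>(b, a). fejer_mean N g a b)"
        unfolding case_prod_unfold by (intro continuous_intros)
      from integral_continuous_on_param[OF this] show ?thesis
        unfolding circ_avg_def by (intro continuous_intros) simp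
    qed
    then show ?thesis
      by (simp add: circ_avg_Re cm)
  qed
  also have "\<dots> = (LINT z|torus2. Omega (norm (f z)))"
    unfolding circ_avg_fejer_mean g_def by simp
  finally show ?thesis .
qed

lemma sum_symmetric_interval_eq:
  fixes h :: "int \<Rightarrow> complex"
  assumes "\<And>m. m < 0 \<Longrightarrow> h m = 0"
  shows "(\<Sum>m\<in>{- int N..int N}. h m) = (\<Sum>m\<le>N. h (int m))"
proof -
  have "(\<Sum>m\<in>{- int N..int N}. h m) = (\<Sum>m\<in>{0..int N}. h m)"
    using assms by (intro sum.mono_neutral_right) auto
  also have "\<dots> = (\<Sum>m\<le>N. h (int m))"
    by (rule sum.reindex_bij_witness[of _ int nat]) auto
  finally show ?thesis .
qed

lemma hardy_coeff_zero:
  assumes "f \<in> hardy_H1" "m < 0 \<or> n < 0"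
  shows "fourier_coeff f m n = 0"
  using assms unfolding hardy_H1_def by force

lemma hardy_coefficients_le:
  assumes f: "f \<in> hardy_H1" and Of: "integrable torus2 (\<lambda>z. Omega (norm (f z)))"
  shows "(\<Sum>k\<le>K. \<Sum>l<k. \<Sum>k'\<le>K. \<Sum>l'<k'. (norm (fourier_coeff f (3 ^ k - 3 ^ l) (3 ^ k' - 3 ^ l')))\<^sup>2)
    \<le> 16 * (coeff_const * (4 * coeff_const * (LINT z|torus2. Omega (norm (f z))))\<^sup>2)"
proof -
  \<comment> \<open>Twice a bound for the frequencies in question, so that each Fejer weight is at
    least 1/2. The two weights together lose at most a factor 4, hence the 16 for squares.\<close>
  define N :: nat where "N = 2 * 3 ^ K"
  have N: "0 < N" "3 ^ K \<le> N" by (simp_all add: N_def)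
  define a where "a = (\<lambda>m n. of_real (fejer_weight N (int m) * fejer_weight N (int n)) * fourier_coeff f (int m) (int n))"
  have fi: "integrable torus2 f"
    using f by (simp add: hardy_H1_def)
  have mean: "(\<Sum>m\<le>N. \<Sum>n\<le>N. a m n * (cis (real m * x) * cis (real n * y))) = fejer_mean N f x y" for x y
  proof -
    have "fejer_mean N f x y = (\<Sum>m\<in>{- int N..int N}. \<Sum>n\<le>N.
      of_real (fejer_weight N m * fejer_weight N (int n)) * fourier_coeff f m (int n) * (cis (of_int m * x) * cis (of_int (int n) * y)))"
      unfolding fejer_mean_def
      by (intro sum.cong refl sum_symmetric_interval_eq) (simp add: hardy_coeff_zero[OF f])
    also have "\<dots> = (\<Sum>m\<le>N. \<Sum>n\<le>N.
      of_real (fejer_weight N (int m) * fejer_weight N (int n)) * fourier_coeff f (int m) (int n) * (cis (of_int (int m) * x) * cis (of_int (int n) * y)))"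
      by (intro sum_symmetric_interval_eq) (simp add: hardy_coeff_zero[OF f])
    finally show ?thesis
      by (simp add: a_def)
  qed
  have coeff: "(norm (fourier_coeff f (3 ^ k - 3 ^ l) (3 ^ k' - 3 ^ l')))\<^sup>2 \<le> 16 * (norm (a (3 ^ k - 3 ^ l) (3 ^ k' - 3 ^ l')))\<^sup>2"
    if "k \<le> K" "l < k" "k' \<le> K" "l' < k'" for k l k' l'
  proof -
    have int: "int (3 ^ k - 3 ^ l) = 3 ^ k - 3 ^ l" if "l < k" for k l :: nat
      using that by (simp add: of_nat_diff power_increasing)
    have w: "1 / 2 \<le> fejer_weight N (3 ^ k - 3 ^ l)" if "k \<le> K" "l < k" for k l :: nat
    proof -
      have "(3::real) ^ l \<le> 3 ^ k" "(3::real) ^ k \<le> 3 ^ K" "0 < (3::real) ^ l"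
        using that by (auto intro!: power_increasing)
      then have "\<bar>3 ^ k - 3 ^ l\<bar> \<le> (3::real) ^ K" by linarith
      then have "\<bar>3 ^ k - 3 ^ l\<bar> / N \<le> (3::real) ^ K / N"
        by (intro divide_right_mono) auto
      then show ?thesis
        by (simp add: fejer_weight_def N_def)
    qed
    have "1 / 2 * (1 / 2) \<le> fejer_weight N (3 ^ k - 3 ^ l) * fejer_weight N (3 ^ k' - 3 ^ l')"
      using w[OF that(1,2)] w[OF that(3,4)] by (intro mult_mono) auto
    then have "norm (fourier_coeff f (3 ^ k - 3 ^ l) (3 ^ k' - 3 ^ l')) * (1 / 4) \<le>
       norm (fourier_coeff f (3 ^ k - 3 ^ l) (3 ^ k' - 3 ^ l')) * \<bar>fejer_weight N (3 ^ k - 3 ^ l) * fejer_weight N (3 ^ k' - 3 ^ l')\<bar>"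
      by (intro mult_left_mono) auto
    also have "\<dots> = norm (a (3 ^ k - 3 ^ l) (3 ^ k' - 3 ^ l'))"
      unfolding a_def int[OF that(2)] int[OF that(4)] by (simp add: norm_mult abs_mult)
    finally have "norm (fourier_coeff f (3 ^ k - 3 ^ l) (3 ^ k' - 3 ^ l')) \<le> 4 * norm (a (3 ^ k - 3 ^ l) (3 ^ k' - 3 ^ l'))"
      by simp
    then have "(norm (fourier_coeff f (3 ^ k - 3 ^ l) (3 ^ k' - 3 ^ l')))\<^sup>2 \<le> (4 * norm (a (3 ^ k - 3 ^ l) (3 ^ k' - 3 ^ l')))\<^sup>2"
      by (intro power_mono) auto
    then show ?thesis by (simp add: power_mult_distrib)
  qed
  have Onn: "0 \<le> circ_avg (\<lambda>y. circ_avg (\<lambda>x. Omega (norm (fejer_mean N f x y))))"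
  proof -
    have cO: "continuous_on UNIV (\<lambda>z. Omega (norm (fejer_mean N f (snd z) (fst z))))"
      by (intro continuous_intros) auto
    have "circ_avg (\<lambda>y. circ_avg (\<lambda>x. 0)) \<le> circ_avg (\<lambda>y. circ_avg (\<lambda>x. Omega (norm (fejer_mean N f x y))))"
    proof (rule circ_avg_mono)
      show "circ_avg (\<lambda>x. 0) \<le> circ_avg (\<lambda>x. Omega (norm (fejer_mean N f x y)))" for y
        by (intro circ_avg_mono Omega_nonneg continuous_on_const continuous_on_Omega continuous_on_norm continuous_on_fejer_mean continuous_on_id) auto
    qed (use continuous_on_circ_avg[OF cO] in simp_all)
    then show ?thesis by simp
  qed
  have "(\<Sum>k\<le>K. \<Sum>l<k. \<Sum>k'\<le>K. \<Sum>l'<k'. (norm (fourier_coeff f (3 ^ k - 3 ^ l) (3 ^ k' - 3 ^ l')))\<^sup>2)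
    \<le> (\<Sum>k\<le>K. \<Sum>l<k. \<Sum>k'\<le>K. \<Sum>l'<k'. 16 * (norm (a (3 ^ k - 3 ^ l) (3 ^ k' - 3 ^ l')))\<^sup>2)"
    by (intro sum_mono coeff) auto
  also have "\<dots> = 16 * (\<Sum>k\<le>K. \<Sum>l<k. \<Sum>k'\<le>K. \<Sum>l'<k'. (norm (a (3 ^ k - 3 ^ l) (3 ^ k' - 3 ^ l')))\<^sup>2)"
    by (simp only: sum_distrib_left)
  also have "\<dots> \<le> 16 * (coeff_const * (4 * coeff_const * circ_avg (\<lambda>y. circ_avg (\<lambda>x. Omega (norm (fejer_mean N f x y)))))\<^sup>2)"
    using double_lacunary_difference_coefficients_le[OF N(2), of a] unfolding mean by (intro mult_left_mono) auto
  also have "\<dots> \<le> 16 * (coeff_const * (4 * coeff_const * (LINT z|torus2. Omega (norm (f z))))\<^sup>2)"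
    using coeff_const_ge Onn circ_avg_Omega_fejer_mean_le[OF fi Of N(1)]
    by (intro mult_left_mono power_mono) auto
  finally show ?thesis .
qed

section \<open>Rearrangements\<close>

text \<open>Used with y = r / M, where r is the rearrangement at \<open>t\<close>. The hypothesis y
  t <= 1 bounds 2 + 2 y by 4 / t, which trades the logarithm of y for |ln t|; where no factor y
  precedes it, the logarithm is bounded linearly.\<close>

lemma Omega_le:
  assumes "0 \<le> y" "0 < t" "t < 1" "y * t \<le> 1"
  shows "Omega (1 + 2 * y) \<le> 4 + 10 * y * (1 + \<bar>ln t\<bar>)"
proof -
  have "ln (2 + 2 * y) \<le> (2 + 2 * y) - 1"
    using assms by (intro ln_le_minus_one) auto
  then have l1: "ln (2 + 2 * y) \<le> 1 + 2 * y" by simp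
  have "2 + 2 * y \<le> 4 / t"
    using assms by (simp add: field_simps)
  then have "ln (2 + 2 * y) \<le> ln (4 / t)"
    using assms by (subst ln_le_cancel_iff) auto
  also have "\<dots> = ln 4 - ln t"
    using assms by (simp add: ln_div)
  also have "\<dots> \<le> 2 + \<bar>ln t\<bar>"
  proof -
    have "ln (4::real) = 2 * ln 2" using ln_realpow[of "2::real" 2] by simp
    moreover have "ln (2::real) \<le> 1" using ln_le_minus_one[of "2::real"] by simp
    ultimately show ?thesis by linarith
  qed
  finally have "2 * y * (1 + ln (2 + 2 * y)) \<le> 2 * y * (3 + \<bar>ln t\<bar>)"
    using assms by (intro mult_left_mono) auto
  then have "Omega (1 + 2 * y) \<le> 2 * (1 + ln (2 + 2 * y)) + 2 * y * (3 + \<bar>ln t\<bar>)"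
    by (simp add: Omega_def algebra_simps)
  also have "\<dots> \<le> 2 * (1 + (1 + 2 * y)) + 2 * y * (3 + \<bar>ln t\<bar>)"
    using l1 by simp
  also have "\<dots> = 4 + 10 * y + 2 * (y * \<bar>ln t\<bar>)"
    by (simp add: algebra_simps)
  also have "\<dots> \<le> 4 + 10 * y + 10 * (y * \<bar>ln t\<bar>)"
    using mult_nonneg_nonneg[OF assms(1) abs_ge_zero[of "ln t"]] by simp
  finally show ?thesis by (simp add: algebra_simps)
qed

lemma rearrangement_antimono: "t \<le> t' \<Longrightarrow> rearrangement f t' \<le> rearrangement f t"
  unfolding rearrangement_def
  by (intro INF_superset_mono) (auto intro: order_trans ennreal_leI)

text \<open>By monotonicity the superlevel sets are intervals.\<close>

lemma rearrangement_measurable [measurable]: "rearrangement f \<in> borel_measurable borel"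
proof (rule borel_measurableI_greater)
  fix y
  have "is_interval {t. y < rearrangement f t}"
    unfolding is_interval_1 by (auto intro: less_le_trans rearrangement_antimono)
  then show "{t \<in> space borel. y < rearrangement f t} \<in> sets borel"
    by (simp add: real_interval_borel_measurable)
qed

text \<open>A Chebyshev type bound: the weight in the norm is at least 1, and on [0, t] the
  rearrangement is at least its value at \<open>t\<close>. It supplies the hypothesis y t <= 1 of
  \<open>Omega_le\<close>.\<close>

lemma times_rearrangement_le_LlogL:
  assumes "0 \<le> t"
  shows "ennreal t * rearrangement f t \<le> LlogL_norm f"
proof -
  have "ennreal t * rearrangement f t = (\<integral>\<^sup>+u. rearrangement f t * indicator {0..t} u \<partial>lborel)"
    using assms by (simp add: nn_integral_cmult_indicator mult.commute)
  also have "\<dots> \<le> LlogL_norm f"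
    unfolding LlogL_norm_def
  proof (rule nn_integral_mono)
    fix u
    show "rearrangement f t * indicator {0..t} u \<le> ennreal (1 + \<bar>ln u\<bar>) * rearrangement f u * indicator {0..} u"
    proof (cases "u \<in> {0..t}")
      case True
      have "1 * rearrangement f t \<le> ennreal (1 + \<bar>ln u\<bar>) * rearrangement f u"
        using True by (intro mult_mono rearrangement_antimono) auto
      then show ?thesis using True by simp
    qed simp
  qed
  finally show ?thesis .
qed

text \<open>In effect a pointwise bound for the rearrangement of Omega(|f| / M) at \<open>t\<close>,
  phrased through the distribution function.\<close>

lemma distribution_Omega_le:
  fixes f :: "real \<times> real \<Rightarrow> complex"
  assumes f [measurable]: "f \<in> borel_measurable torus2" and M: "0 < M" "LlogL_norm f \<le> ennreal M"
    and t: "0 < t" "t < 1" and s: "0 \<le> s"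
    and less: "ennreal t < emeasure torus2 {z \<in> space torus2. s < Omega (norm (f z) / M)}"
  shows "ennreal s \<le> 4 + ennreal (10 / M) * (ennreal (1 + \<bar>ln t\<bar>) * rearrangement f t)"
proof -
  have tr: "ennreal t * rearrangement f t \<le> ennreal M"
    using times_rearrangement_le_LlogL[of t f] t M(2) by (auto intro: order_trans)
  then have "rearrangement f t \<noteq> \<top>"
    using t by (auto simp: ennreal_mult_top top_unique)
  then obtain r where r: "rearrangement f t = ennreal r" "0 \<le> r"
    by (cases "rearrangement f t" rule: ennreal_cases) auto
  have trM: "r * t \<le> M"
    using tr t r M(1) by (simp add: r(1) ennreal_mult[symmetric] mult.commute)
  \<comment> \<open>The slack r + M is positive even if r = 0, so an admissible level
    \<open>u\<close> of at most 2 r + M exists although the infimum need not be attained. Division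
    by M gives the 1 + 2 y of \<open>Omega_le\<close>.\<close>
  have "rearrangement f t < ennreal (2 * r + M)"
    unfolding r(1) using M(1) r(2) by (intro ennreal_lessI) auto
  then obtain u where u: "0 < u" "emeasure torus2 {z \<in> space torus2. norm (f z) > u} \<le> ennreal t" "u \<le> 2 * r + M"
    unfolding rearrangement_def INF_less_iff using ennreal_less_iff by (fastforce simp: less_imp_le)
  \<comment> \<open>The first set has measure above \<open>t\<close> and the second at most
    \<open>t\<close>, so some point has Omega above \<open>s\<close> and yet |f| <= u.\<close>
  have "\<not> {z \<in> space torus2. s < Omega (norm (f z) / M)} \<subseteq> {z \<in> space torus2. norm (f z) > u}"
  proof
    assume "{z \<in> space torus2. s < Omega (norm (f z) / M)} \<subseteq> {z \<in> space torus2. norm (f z) > u}"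
    then have "emeasure torus2 {z \<in> space torus2. s < Omega (norm (f z) / M)} \<le> emeasure torus2 {z \<in> space torus2. norm (f z) > u}"
      by (rule emeasure_mono) measurable
    with u(2) less show False by (meson leD order_trans)
  qed
  then obtain z where "s < Omega (norm (f z) / M)" "\<not> norm (f z) > u"
    by blast
  then have z: "s < Omega (norm (f z) / M)" "norm (f z) \<le> u"
    by simp_all
  define y where "y = r / M"
  have "norm (f z) / M \<le> 1 + 2 * y"
    using z(2) u(3) M(1) by (simp add: y_def field_simps)
  then have "Omega (norm (f z) / M) \<le> Omega (1 + 2 * y)"
    using M(1) by (intro Omega_mono) auto
  also have "\<dots> \<le> 4 + 10 * y * (1 + \<bar>ln t\<bar>)"
    using r(2) M(1) t trM by (intro Omega_le) (auto simp: y_def field_simps)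
  finally have "s \<le> 4 + 10 / M * ((1 + \<bar>ln t\<bar>) * r)"
    using z(1) by (simp add: y_def mult_ac)
  then have "ennreal s \<le> ennreal (4 + 10 / M * ((1 + \<bar>ln t\<bar>) * r))"
    by (rule ennreal_leI)
  also have "\<dots> = 4 + ennreal (10 / M) * (ennreal (1 + \<bar>ln t\<bar>) * rearrangement f t)"
  proof -
    have "ennreal (4 + w) = 4 + ennreal w" if "0 \<le> w" for w
      using that ennreal_plus[of 4 w] by simp
    moreover have "ennreal (10 / M * ((1 + \<bar>ln t\<bar>) * r)) = ennreal (10 / M) * ennreal ((1 + \<bar>ln t\<bar>) * r)"
      using M(1) r(2) by (intro ennreal_mult) auto
    moreover have "ennreal ((1 + \<bar>ln t\<bar>) * r) = ennreal (1 + \<bar>ln t\<bar>) * ennreal r"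
      using r(2) by (intro ennreal_mult) auto
    ultimately show ?thesis
      using M(1) r(2) unfolding r(1) by simp
  qed
  finally show ?thesis .
qed

lemma nn_integral_layer_cake:
  fixes X :: "'a \<Rightarrow> real"
  assumes "sigma_finite_measure M" and X [measurable]: "X \<in> borel_measurable M" and nonneg: "\<And>z. 0 \<le> X z"
  shows "(\<integral>\<^sup>+z. ennreal (X z) \<partial>M) = (\<integral>\<^sup>+s. emeasure M {z \<in> space M. s < X z} * indicator {0..} s \<partial>lborel)"
proof -
  interpret M: sigma_finite_measure M by fact
  interpret P: pair_sigma_finite M lborel ..
  have "(\<integral>\<^sup>+z. ennreal (X z) \<partial>M) = (\<integral>\<^sup>+z. \<integral>\<^sup>+s. indicator {0..<X z} s \<partial>lborel \<partial>M)"
    using nonneg by (intro nn_integral_cong) simp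
  also have "\<dots> = (\<integral>\<^sup>+z. \<integral>\<^sup>+s. indicator {z \<in> space M. s < X z} z * indicator {0..} s \<partial>lborel \<partial>M)"
    by (intro nn_integral_cong) (auto simp: indicator_def)
  also have "\<dots> = (\<integral>\<^sup>+s. \<integral>\<^sup>+z. indicator {z \<in> space M. s < X z} z * indicator {0..} s \<partial>M \<partial>lborel)"
    by (rule P.Fubini'[symmetric]) measurable
  also have "\<dots> = (\<integral>\<^sup>+s. emeasure M {z \<in> space M. s < X z} * indicator {0..} s \<partial>lborel)"
    by (intro nn_integral_cong) (simp add: nn_integral_multc)
  finally show ?thesis .
qed

text \<open>Layer cake twice: the integral is the area below the distribution function
  \<open>m\<close>, and for fixed \<open>t\<close> the levels \<open>s\<close> with t < m s lie in
  [0, Z t] by \<open>distribution_Omega_le\<close>. Integrating \<open>Z\<close> over (0, 1) gives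
  at most 4 + 10, because the norm is at most \<open>M\<close>.\<close>

lemma nn_integral_Omega_le:
  fixes f :: "real \<times> real \<Rightarrow> complex"
  assumes f [measurable]: "f \<in> borel_measurable torus2" and M: "0 < M" "LlogL_norm f \<le> ennreal M"
  shows "(\<integral>\<^sup>+z. ennreal (Omega (norm (f z) / M)) \<partial>torus2) \<le> 14"
proof -
  define X where "X = (\<lambda>z. Omega (norm (f z) / M))"
  define Z where "Z = (\<lambda>t. 4 + ennreal (10 / M) * (ennreal (1 + \<bar>ln t\<bar>) * rearrangement f t))"
  define m where "m = (\<lambda>s. emeasure torus2 {z \<in> space torus2. s < X z})"
  have X [measurable]: "X \<in> borel_measurable torus2"
    unfolding X_def Omega_def by measurable
  have m_anti: "m s' \<le> m s" if "s \<le> s'" for s s'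
    unfolding m_def using that by (intro emeasure_mono) (auto, measurable)
  have [measurable]: "m \<in> borel_measurable borel"
  proof (rule borel_measurableI_greater)
    fix y
    have "is_interval {s. y < m s}"
      unfolding is_interval_1 by (auto intro: less_le_trans m_anti)
    then show "{s \<in> space borel. y < m s} \<in> sets borel"
      by (simp add: real_interval_borel_measurable)
  qed
  have m1: "m s \<le> 1" for s
    unfolding m_def by (rule torus2.emeasure_le_1)
  have "(\<integral>\<^sup>+z. ennreal (X z) \<partial>torus2) = (\<integral>\<^sup>+s. m s * indicator {0..} s \<partial>lborel)"
    unfolding m_def using M(1)
    by (intro nn_integral_layer_cake X torus2.sigma_finite_measure_axioms) (simp add: X_def Omega_nonneg)
  also have "\<dots> = (\<integral>\<^sup>+s. \<integral>\<^sup>+t. indicator {t. 0 < t \<and> ennreal t < m s} t * indicator {0..} s \<partial>lborel \<partial>lborel)"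
  proof (intro nn_integral_cong)
    fix s :: real
    obtain r where r: "m s = ennreal r" "0 \<le> r"
      using m1[of s] by (cases "m s" rule: ennreal_cases) (auto simp: top_unique)
    have "{t. 0 < t \<and> ennreal t < m s} = {0<..<r}"
      unfolding r(1) by (auto simp: ennreal_less_iff)
    then show "m s * indicator {0..} s = (\<integral>\<^sup>+t. indicator {t. 0 < t \<and> ennreal t < m s} t * indicator {0..} s \<partial>lborel)"
      using r by (simp add: nn_integral_multc)
  qed
  also have "\<dots> = (\<integral>\<^sup>+t. \<integral>\<^sup>+s. indicator {t. 0 < t \<and> ennreal t < m s} t * indicator {0..} s \<partial>lborel \<partial>lborel)"
    by (rule lborel_pair.Fubini') measurable
  also have "\<dots> \<le> (\<integral>\<^sup>+t. Z t * indicator {0<..<1::real} t \<partial>lborel)"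
  proof (rule nn_integral_mono)
    fix t :: real
    show "(\<integral>\<^sup>+s. indicator {t. 0 < t \<and> ennreal t < m s} t * indicator {0..} s \<partial>lborel) \<le> Z t * indicator {0<..<1::real} t"
    proof (cases "t \<in> {0<..<1}")
      case True
      have "(\<integral>\<^sup>+s. indicator {t. 0 < t \<and> ennreal t < m s} t * indicator {0..} s \<partial>lborel) \<le> Z t"
      proof (cases "Z t" rule: ennreal_cases)
        case (real y)
        have "(\<integral>\<^sup>+s. indicator {t. 0 < t \<and> ennreal t < m s} t * indicator {0..} s \<partial>lborel) \<le> (\<integral>\<^sup>+s. indicator {0..y} s \<partial>lborel)"
        proof (rule nn_integral_mono)
          fix s :: real
          have "s \<le> y" if "ennreal t < m s" "0 \<le> s"
          proof -
            have "ennreal s \<le> Z t"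
              using distribution_Omega_le[OF f M _ _ that(2)] that(1) True unfolding Z_def m_def X_def by auto
            then show ?thesis using real by simp
          qed
          then show "indicator {t. 0 < t \<and> ennreal t < m s} t * indicator {0..} s \<le> (indicator {0..y} s :: ennreal)"
            by (auto simp: indicator_def)
        qed
        also have "\<dots> = Z t"
          using real by simp
        finally show ?thesis .
      qed simp
      then show ?thesis using True by simp
    next
      \<comment> \<open>The total mass is 1, so \<open>m\<close> never exceeds 1 and the inner
        integral vanishes for t >= 1.\<close>
      case False
      have "\<not> (0 < t \<and> ennreal t < m s)" for s
      proof
        assume "0 < t \<and> ennreal t < m s"
        then have "ennreal t < ennreal 1"
          unfolding ennreal_1 using m1[of s] by (blast intro: less_le_trans)
        with False \<open>0 < t \<and> ennreal t < m s\<close> show False by (simp add: ennreal_less_iff)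
      qed
      then show ?thesis by simp
    qed
  qed
  also have "\<dots> \<le> (\<integral>\<^sup>+t. 4 * indicator {0<..<1::real} t + ennreal (10 / M) * (ennreal (1 + \<bar>ln t\<bar>) * rearrangement f t * indicator {0..} t) \<partial>lborel)"
    by (intro nn_integral_mono) (auto simp: Z_def indicator_def)
  also have "\<dots> = (\<integral>\<^sup>+t. 4 * indicator {0<..<1::real} t \<partial>lborel) + (\<integral>\<^sup>+t. ennreal (10 / M) * (ennreal (1 + \<bar>ln t\<bar>) * rearrangement f t * indicator {0..} t) \<partial>lborel)"
    by (rule nn_integral_add) measurable
  also have "(\<integral>\<^sup>+t. 4 * indicator {0<..<1::real} t \<partial>lborel) = (4::ennreal)"
    by (simp add: nn_integral_cmult_indicator)
  also have "(\<integral>\<^sup>+t. ennreal (10 / M) * (ennreal (1 + \<bar>ln t\<bar>) * rearrangement f t * indicator {0..} t) \<partial>lborel) = ennreal (10 / M) * LlogL_norm f"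
    unfolding LlogL_norm_def by (intro nn_integral_cmult) measurable
  also have "4 + ennreal (10 / M) * LlogL_norm f \<le> 4 + ennreal (10 / M) * ennreal M"
    using M(2) by (intro add_left_mono mult_left_mono) auto
  also have "\<dots> = 14"
    using M(1) by (simp add: ennreal_mult[symmetric])
  finally show ?thesis unfolding X_def .
qed

section \<open>The inequality\<close>

text \<open>The infinite sum is a supremum over finite sets; this puts each of them inside a range
  of exponents that the finite estimate covers.\<close>

lemma finite_subset_Lambda_square:
  assumes "finite F" "F \<subseteq> Lambda \<times> Lambda"
  obtains K where "F \<subseteq> (\<lambda>((k, l), k', l'). (3 ^ k - 3 ^ l, 3 ^ k' - 3 ^ l')) `
    (Sigma {..K} (\<lambda>k. {..<k}) \<times> Sigma {..K} (\<lambda>k. {..<k}))"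
proof -
  have "\<forall>p\<in>F. \<exists>k l k' l' :: nat. l < k \<and> l' < k' \<and> p = (3 ^ k - 3 ^ l, 3 ^ k' - 3 ^ l')"
  proof
    fix p assume "p \<in> F"
    then obtain m n where p: "p = (m, n)" "m \<in> Lambda" "n \<in> Lambda"
      using assms(2) by blast
    obtain k l :: nat where "m = 3 ^ k - 3 ^ l" "l < k"
      using p(2) unfolding Lambda_def by blast
    moreover obtain k' l' :: nat where "n = 3 ^ k' - 3 ^ l'" "l' < k'"
      using p(3) unfolding Lambda_def by blast
    ultimately show "\<exists>k l k' l' :: nat. l < k \<and> l' < k' \<and> p = (3 ^ k - 3 ^ l, 3 ^ k' - 3 ^ l')"
      unfolding p(1) by blast
  qed
  then obtain k l k' l' :: "int \<times> int \<Rightarrow> nat"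
    where kl: "\<And>p. p \<in> F \<Longrightarrow> l p < k p \<and> l' p < k' p \<and> p = (3 ^ k p - 3 ^ l p, 3 ^ k' p - 3 ^ l' p)"
    by metis
  define K where "K = Max (insert 0 (k ` F \<union> k' ` F))"
  have K: "k p \<le> K" "k' p \<le> K" if "p \<in> F" for p
    unfolding K_def using that assms(1) by (auto intro!: Max_ge)
  have "p \<in> (\<lambda>((k, l), k', l'). (3 ^ k - 3 ^ l, 3 ^ k' - 3 ^ l')) ` (Sigma {..K} (\<lambda>k. {..<k}) \<times> Sigma {..K} (\<lambda>k. {..<k}))"
    if "p \<in> F" for p
  proof (rule image_eqI)
    show "p = (\<lambda>((k, l), k', l'). (3 ^ k - 3 ^ l, 3 ^ k' - 3 ^ l')) ((k p, l p), k' p, l' p)"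
      unfolding prod.case using kl[OF that] by blast
    show "((k p, l p), k' p, l' p) \<in> Sigma {..K} (\<lambda>k. {..<k}) \<times> Sigma {..K} (\<lambda>k. {..<k})"
      using kl[OF that] K[OF that] by simp
  qed
  with that show ?thesis by blast
qed

lemma fourier_coeff_divide: "fourier_coeff (\<lambda>z. f z / c) m n = fourier_coeff f m n / c"
  unfolding fourier_coeff_def case_prod_unfold times_divide_eq_left by simp

lemma hardy_divide: "f \<in> hardy_H1 \<Longrightarrow> (\<lambda>z. f z / c) \<in> hardy_H1"
  by (auto simp: hardy_H1_def fourier_coeff_divide)

text \<open>Dividing f by \<open>M\<close> brings the mean of \<open>Omega\<close> down to at most
  14, and linearity of the coefficients returns the factor \<open>M\<close>.\<close>

lemma hardy_coefficient_sum_le_LlogL: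
  assumes f: "f \<in> hardy_H1" and M: "0 < M" "LlogL_norm f \<le> ennreal M"
  shows "(\<Sum>k\<le>K. \<Sum>l<k. \<Sum>k'\<le>K. \<Sum>l'<k'. (norm (fourier_coeff f (3 ^ k - 3 ^ l) (3 ^ k' - 3 ^ l')))\<^sup>2)
    \<le> (224 * coeff_const\<^sup>2 * M)\<^sup>2"
proof -
  let ?C = coeff_const
  define g where "g = (\<lambda>z. f z / complex_of_real M)"
  have g: "g \<in> hardy_H1"
    unfolding g_def using f by (rule hardy_divide)
  have [measurable]: "f \<in> borel_measurable torus2"
    using f unfolding hardy_H1_def by auto
  have ng: "norm (g z) = norm (f z) / M" for z
    using M(1) by (simp add: g_def norm_divide)
  have nn: "(\<integral>\<^sup>+z. ennreal (Omega (norm (g z))) \<partial>torus2) \<le> 14"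
    unfolding ng by (rule nn_integral_Omega_le[OF _ M]) measurable
  have meas: "(\<lambda>z. Omega (norm (g z))) \<in> borel_measurable torus2"
    unfolding ng Omega_def by measurable
  have int: "integrable torus2 (\<lambda>z. Omega (norm (g z)))"
    using nn by (intro integrableI_nonneg meas) (auto simp: Omega_nonneg intro: le_less_trans)
  have "ennreal (LINT z|torus2. Omega (norm (g z))) \<le> ennreal 14"
    using nn nn_integral_eq_integral[OF int] by (simp add: Omega_nonneg)
  then have le14: "(LINT z|torus2. Omega (norm (g z))) \<le> 14"
    by (subst (asm) ennreal_le_iff) auto
  have nonneg: "0 \<le> (LINT z|torus2. Omega (norm (g z)))"
    by (simp add: Omega_nonneg)
  let ?S = "\<lambda>h. \<Sum>k\<le>K. \<Sum>l<k. \<Sum>k'\<le>K. \<Sum>l'<k'. (norm (fourier_coeff h (3 ^ k - 3 ^ l) (3 ^ k' - 3 ^ l')))\<^sup>2"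
  have "?S g \<le> 16 * (?C * (4 * ?C * (LINT z|torus2. Omega (norm (g z))))\<^sup>2)"
    by (rule hardy_coefficients_le[OF g int])
  also have "\<dots> \<le> 16 * (?C * (4 * ?C * 14)\<^sup>2)"
    using coeff_const_ge le14 nonneg by (intro mult_left_mono power_mono) auto
  \<comment> \<open>16 (4 * 14)^2 = 224^2, and C >= 1 raises C^3 to the perfect square C^4.\<close>
  also have "\<dots> \<le> (224 * ?C\<^sup>2)\<^sup>2"
  proof -
    have "?C * ?C\<^sup>2 \<le> ?C\<^sup>2 * ?C\<^sup>2"
      using coeff_const_ge by (intro mult_right_mono) (auto simp: power2_eq_square)
    then show ?thesis by (simp add: power_mult_distrib power2_eq_square mult_ac)
  qed
  finally have "M\<^sup>2 * ?S g \<le> M\<^sup>2 * (224 * ?C\<^sup>2)\<^sup>2"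
    by (intro mult_left_mono) auto
  moreover have "?S f = M\<^sup>2 * ?S g"
    using M(1) by (simp add: g_def fourier_coeff_divide norm_divide power_divide sum_distrib_left)
  ultimately show ?thesis
    by (simp add: power_mult_distrib mult_ac)
qed

lemma infsum_coefficients_le:
  assumes f: "f \<in> hardy_H1" and M: "0 < M" "LlogL_norm f \<le> ennreal M"
  shows "(\<Sum>\<^sub>\<infinity>(m, n)\<in>Lambda \<times> Lambda. ennreal ((norm (fourier_coeff f m n))\<^sup>2)) \<le> ennreal ((224 * coeff_const\<^sup>2 * M)\<^sup>2)"
proof -
  let ?h = "\<lambda>(m, n). (norm (fourier_coeff f m n))\<^sup>2"
  have "(\<Sum>(m, n)\<in>F. ennreal ((norm (fourier_coeff f m n))\<^sup>2)) \<le> ennreal ((224 * coeff_const\<^sup>2 * M)\<^sup>2)"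
    if F: "finite F" "F \<subseteq> Lambda \<times> Lambda" for F
  proof -
    obtain K where K: "F \<subseteq> (\<lambda>((k, l), k', l'). (3 ^ k - 3 ^ l, 3 ^ k' - 3 ^ l')) `
        (Sigma {..K} (\<lambda>k. {..<k}) \<times> Sigma {..K} (\<lambda>k. {..<k}))" (is "_ \<subseteq> ?\<phi> ` ?P")
      using finite_subset_Lambda_square[OF F] .
    have P: "finite ?P" by auto
    have "sum ?h F \<le> sum ?h (?\<phi> ` ?P)"
      using K P by (intro sum_mono2) auto
    \<comment> \<open>The terms are nonnegative, so summing over the parameters instead of over
      their image can only increase the sum.\<close>
    also have "\<dots> \<le> sum (?h \<circ> ?\<phi>) ?P"
      by (rule sum_image_le[OF P]) auto
    also have "\<dots> = (\<Sum>k\<le>K. \<Sum>l<k. \<Sum>k'\<le>K. \<Sum>l'<k'. (norm (fourier_coeff f (3 ^ k - 3 ^ l) (3 ^ k' - 3 ^ l')))\<^sup>2)"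
    proof -
      have *: "(\<Sum>k\<le>K. \<Sum>l<k. H k l) = (\<Sum>i\<in>Sigma {..K} (\<lambda>k. {..<k}). H (fst i) (snd i))" for H :: "nat \<Rightarrow> nat \<Rightarrow> real"
        by (simp add: sum.Sigma case_prod_unfold)
      show ?thesis
        unfolding *
        unfolding sum.cartesian_product
        by (simp only: comp_def case_prod_unfold fst_conv snd_conv)
    qed
    also have "\<dots> \<le> (224 * coeff_const\<^sup>2 * M)\<^sup>2"
      by (rule hardy_coefficient_sum_le_LlogL[OF f M])
    finally have "ennreal (sum ?h F) \<le> ennreal ((224 * coeff_const\<^sup>2 * M)\<^sup>2)"
      by (rule ennreal_leI)
    then show ?thesis
      by (subst (asm) sum_ennreal[symmetric]) (auto simp: case_prod_unfold)
  qed
  then show ?thesis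
    by (subst nonneg_infsum_complete, simp) (rule SUP_least, blast)
qed

theorem theorem11:
  shows "\<exists>C\<^sub>0::real. C\<^sub>0 > 0 \<and>
    (\<forall>f\<in>hardy_H1.
      ennreal_sqrt (\<Sum>\<^sub>\<infinity>(m, n)\<in>Lambda \<times> Lambda. ennreal ((norm (fourier_coeff f m n))\<^sup>2))
        \<le> ennreal C\<^sub>0 * LlogL_norm f)"
proof (intro exI[of _ "224 * coeff_const\<^sup>2"] conjI ballI)
  let ?C = "224 * coeff_const\<^sup>2"
  show C: "0 < ?C"
    using coeff_const_ge by simp
  fix f assume f: "f \<in> hardy_H1"
  let ?S = "\<Sum>\<^sub>\<infinity>(m, n)\<in>Lambda \<times> Lambda. ennreal ((norm (fourier_coeff f m n))\<^sup>2)"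
  show "ennreal_sqrt ?S \<le> ennreal ?C * LlogL_norm f"
  proof (cases "LlogL_norm f" rule: ennreal_cases)
    case top
    then show ?thesis
      using C by (simp add: ennreal_mult_top)
  next
    case (real L)
    show ?thesis
    proof (rule ennreal_le_epsilon)
      fix e :: real assume e: "0 < e"
      \<comment> \<open>Normalisation divides by \<open>M\<close>, which has to be positive even if
        the norm \<open>L\<close> is 0; the excess over \<open>L\<close> costs exactly
        \<open>e\<close> in the end.\<close>
      define M where "M = L + e / ?C"
      have M: "0 < M" "LlogL_norm f \<le> ennreal M"
        using real e C by (auto simp: M_def intro!: ennreal_leI add_nonneg_pos divide_pos_pos)
      have S: "?S \<le> ennreal ((?C * M)\<^sup>2)"
        by (rule infsum_coefficients_le[OF f M])
      then obtain r where r: "?S = ennreal r" "0 \<le> r"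
        by (cases ?S rule: ennreal_cases) (auto simp: top_unique)
      have "r \<le> (?C * M)\<^sup>2"
        using S unfolding r(1) by (subst (asm) ennreal_le_iff) auto
      then have "sqrt r \<le> ?C * M"
        using M(1) C by (intro real_le_lsqrt) auto
      also have "?C * M = ?C * L + e"
        using C by (simp add: M_def distrib_left)
      finally have "ennreal (sqrt r) \<le> ennreal (?C * L + e)"
        by (rule ennreal_leI)
      also have "\<dots> = ennreal ?C * LlogL_norm f + ennreal e"
        using real C e by (simp add: ennreal_mult ennreal_plus)
      finally show "ennreal_sqrt ?S \<le> ennreal ?C * LlogL_norm f + ennreal e"
        using r by (simp add: ennreal_sqrt_def)
    qed
  qed
qed

end
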